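(* Let $(X,D)$ and $(Y,D')$ be two toric pairs (each of dimension at least $1$) defined over the same perfect field $k$. Let $(X\times Y,D\boxtimes D')$ be the toric pair given by the Segre product of $(X,D)$ and $(Y,D')$, where $D\boxtimes D'$ denotes a (torus-invariant) divisor corresponding to the line bundle $\pi_1^*\mathcal{O}_X(D)\otimes\pi_2^*\mathcal{O}_Y(D')$ and $\pi_1:X\times Y\to X$, $\pi_2:X\times Y\to Y$ are the projections. Then $$(1-\varphi_{X\times Y,\,D\boxtimes D'})=(1-\varphi_{X,D})(1-\varphi_{Y,D'})$$ as functions on $[0,\infty)$.
   Context: Toric pair: Let $T$ be a torus with cocharacter lattice $N\cong\mathbb{Z}^{n}$ and character lattice $M=\mathrm{Hom}(N,\mathbb{Z})$, identified with $\mathbb{Z}^{n}$, so $M_{\mathbb{R}}=\mathbb{R}^{n}$. A toric pair $(X,D)$ of dimension $n\ge1$ over a field consists of a projective toric variety $X$ of dimension $n$, given by a complete fan in $N_{\mathbb{R}}$ whose rays have primitive generators $v_1,\dots,v_s$, and a very ample $T$-Cartier divisor $D=\sum_i a_iD_i$ on $X$ ($a_i\in\mathbb{Z}$, $D_i$ the $T$-invariant prime divisor corresponding to $v_i$). Its associated lattice polytope is $P_D=\{u\in M_{\mathbb{R}}\mid \langle u,v_i\rangle\ge -a_i \text{ for all } i\}$. For a toric pair $(X,D)$ of dimension $n$, let $C_D\subset\mathbb{R}^{n+1}$ be the convex cone (with apex the origin) spanned by $P_D\times\{1\}\subset\mathbb{R}^{n}\times\mathbb{R}$, let $z$ denote the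 last coordinate of $\mathbb{R}^{n+1}$, and let $W_v=v+[0,1]^{n}\subset\mathbb{R}^{n}$ for $v\in\mathbb{Z}^n$. The function $\varphi_{X,D}:[0,\infty)\to[0,1]$ (also written $\varphi_D$) is $$\varphi_{X,D}(\lambda)=\mathrm{Vol}_{n}\Big(\big[W_v\times\{z=\lambda+1\}\big]\setminus\bigcup_{u\in\mathbb{Z}^{n}}\big[(u,1)+C_D\big]\Big),$$ which does not depend on the choice of $v\in\mathbb{Z}^n$. Here $W_v\times\{z=\mu\}=\{(x,\mu)\mid x\in W_v\}$ and $\mathrm{Vol}_n$ is $n$-dimensional Lebesgue volume in the hyperplane $\{z=\mu\}$. *)

theory Defs
  imports
    "HOL-Analysis.Analysis"
    "HOL-Library.Poly_Mapping"
    "HOL-Computational_Algebra.Polynomial"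
    "HOL-Computational_Algebra.Fraction_Field"
begin

section \<open>Lattices and fans\<close>

text \<open>
  The cocharacter lattice \<open>N\<close> and the character lattice \<open>M\<close> are both \<open>int ^ 'n\<close>, with
  \<open>n = CARD('n) \<ge> 1\<close>, and the duality pairing is the standard one; the pairing of \<open>M\<close> with
  \<open>N\<^sub>\<real>\<close> is the inner product of \<open>real ^ 'n\<close>.
\<close>

definition rvec :: "int ^ 'n \<Rightarrow> real ^ 'n" where
  "rvec u = (\<chi> i. real_of_int (u $ i))"

definition pairing :: "int ^ 'n \<Rightarrow> int ^ 'n \<Rightarrow> int" where
  "pairing u v = (\<Sum>i\<in>UNIV. u $ i * v $ i)"

definition primitive :: "int ^ 'n \<Rightarrow> bool" where
  "primitive v \<longleftrightarrow> Gcd (range (\<lambda>i. v $ i)) = 1"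

definition rational_polyhedral_cone :: "(real ^ 'n) set \<Rightarrow> bool" where
  "rational_polyhedral_cone \<sigma> \<longleftrightarrow>
     (\<exists>S :: (int ^ 'n) set. finite S \<and> \<sigma> = convex_cone hull (rvec ` S))"

definition strongly_convex :: "(real ^ 'n) set \<Rightarrow> bool" where
  "strongly_convex \<sigma> \<longleftrightarrow> \<sigma> \<inter> uminus ` \<sigma> = {0}"

text \<open>
  The library relation \<open>face_of\<close> also admits the empty face, which is not a face in the sense
  of toric geometry.
\<close>

definition fan :: "(real ^ 'n) set set \<Rightarrow> bool" where
  "fan F \<longleftrightarrow> finite F \<and>
     (\<forall>\<sigma>\<in>F. rational_polyhedral_cone \<sigma> \<and> strongly_convex \<sigma>) \<and>
     (\<forall>\<sigma>\<in>F. \<forall>\<tau>. \<tau> face_of \<sigma> \<and> \<tau> \<noteq> {} \<longrightarrow> \<tau> \<in> F) \<and>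
     (\<forall>\<sigma>\<in>F. \<forall>\<tau>\<in>F. (\<sigma> \<inter> \<tau>) face_of \<sigma> \<and> (\<sigma> \<inter> \<tau>) face_of \<tau>)"

definition complete_fan :: "(real ^ 'n) set set \<Rightarrow> bool" where
  "complete_fan F \<longleftrightarrow> fan F \<and> \<Union>F = UNIV"

text \<open>
  The primitive generators \<open>v\<^sub>i\<close> of the rays. A torus-invariant divisor \<open>\<Sum> a\<^sub>i D\<^sub>i\<close> is
  given by a function \<open>a :: int ^ 'n \<Rightarrow> int\<close>, of which only the values \<open>a\<^sub>i = a v\<^sub>i\<close> at these
  generators are ever used.
\<close>

definition ray_generators :: "(real ^ 'n) set set \<Rightarrow> (int ^ 'n) set" where
  "ray_generators F = {v. primitive v \<and> convex_cone hull {rvec v} \<in> F}"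

section \<open>The ring of Laurent polynomials\<close>

text \<open>
  The coordinate ring \<open>k[M]\<close> of the torus. The type is a copy of \<open>(int ^ 'n) \<Rightarrow>\<^sub>0 'k\<close>: the
  library only makes the latter an integral domain for linearly ordered exponents.
\<close>

typedef (overloaded) ('n, 'k) laurent = "UNIV :: ((int ^ 'n) \<Rightarrow>\<^sub>0 'k::zero) set"
  by simp

setup_lifting type_definition_laurent

instantiation laurent :: (finite, comm_ring_1) comm_ring_1
begin

lift_definition zero_laurent :: "('a, 'b) laurent" is 0 .
lift_definition one_laurent :: "('a, 'b) laurent" is 1 .
lift_definition plus_laurent :: "('a, 'b) laurent \<Rightarrow> ('a, 'b) laurent \<Rightarrow> ('a, 'b) laurent" is "(+)" .
lift_definition minus_laurent :: "('a, 'b) laurent \<Rightarrow> ('a, 'b) laurent \<Rightarrow> ('a, 'b) laurent" is "(-)" .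
lift_definition uminus_laurent :: "('a, 'b) laurent \<Rightarrow> ('a, 'b) laurent" is uminus .
lift_definition times_laurent :: "('a, 'b) laurent \<Rightarrow> ('a, 'b) laurent \<Rightarrow> ('a, 'b) laurent" is "(*)" .

instance
  by intro_classes (transfer, simp add: algebra_simps)+

end

lift_definition coeff_laurent :: "('n, 'k::zero) laurent \<Rightarrow> int ^ 'n \<Rightarrow> 'k" is Poly_Mapping.lookup .

definition support :: "('n, 'k::zero) laurent \<Rightarrow> (int ^ 'n) set" where
  "support f = {m. coeff_laurent f m \<noteq> 0}"

lift_definition monomial :: "int ^ 'n \<Rightarrow> 'k::zero \<Rightarrow> ('n, 'k) laurent" is Poly_Mapping.single .

lemma ex_translation_invariant_order:
  "\<exists>R :: int ^ 'n::finite \<Rightarrow> int ^ 'n \<Rightarrow> bool.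
     transp R \<and> totalp R \<and> irreflp R \<and> (\<forall>x y z. R x y \<longrightarrow> R (x + z) (y + z))"
proof -
  obtain h :: "'n \<Rightarrow> nat" where h: "inj h"
    using finite_imp_inj_to_nat_seg[of "UNIV :: 'n set"] by auto
  define R :: "int ^ 'n \<Rightarrow> int ^ 'n \<Rightarrow> bool"
    where "R x y \<longleftrightarrow> (\<exists>i. x $ i < y $ i \<and> (\<forall>j. h j < h i \<longrightarrow> x $ j = y $ j))" for x y
  have "transp R"
  proof (rule transpI)
    fix x y z assume "R x y" "R y z"
    then obtain i j where i: "x $ i < y $ i" "\<And>l. h l < h i \<Longrightarrow> x $ l = y $ l"
      and j: "y $ j < z $ j" "\<And>l. h l < h j \<Longrightarrow> y $ l = z $ l"
      unfolding R_def by blast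
    consider "h i < h j" | "h j < h i" | "h i = h j" by linarith
    then show "R x z"
    proof cases
      case 1
      then show ?thesis unfolding R_def using i j by (metis less_trans)
    next
      case 2
      then show ?thesis unfolding R_def using i j by (metis less_trans)
    next
      case 3
      then have "i = j" using h by (simp add: inj_eq)
      then show ?thesis unfolding R_def using i j by (metis less_trans)
    qed
  qed
  moreover have "totalp R"
  proof (rule totalpI)
    fix x y :: "int ^ 'n" assume "x \<noteq> y"
    then have ex: "\<exists>i. x $ i \<noteq> y $ i" by (simp add: vec_eq_iff)
    define i where "i = (ARG_MIN h i. x $ i \<noteq> y $ i)"
    have i: "x $ i \<noteq> y $ i" "\<And>j. x $ j \<noteq> y $ j \<Longrightarrow> h i \<le> h j"
      using ex arg_min_nat_lemma[of "\<lambda>i. x $ i \<noteq> y $ i" _ h] unfolding i_def by blast+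
    have "x $ j = y $ j" if "h j < h i" for j
      using i(2) that by (meson not_le)
    then show "R x y \<or> R y x"
      unfolding R_def using i(1) by (metis linorder_neqE)
  qed
  moreover have "irreflp R"
    by (rule irreflpI) (simp add: R_def)
  moreover have "\<forall>x y z. R x y \<longrightarrow> R (x + z) (y + z)"
    by (simp add: R_def)
  ultimately show ?thesis by blast
qed

lemma poly_mapping_vec_mult_neq_0:
  fixes f g :: "(int ^ 'n::finite) \<Rightarrow>\<^sub>0 'k::idom"
  assumes "f \<noteq> 0" "g \<noteq> 0"
  shows "f * g \<noteq> 0"
proof -
  obtain R :: "int ^ 'n \<Rightarrow> int ^ 'n \<Rightarrow> bool"
    where R: "transp R" "totalp R" "irreflp R" "\<And>x y z. R x y \<Longrightarrow> R (x + z) (y + z)"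
    using ex_translation_invariant_order by blast
  have max: "\<exists>a\<in>Poly_Mapping.keys p. \<forall>x\<in>Poly_Mapping.keys p. x \<noteq> a \<longrightarrow> R x a" if "p \<noteq> 0"
    for p :: "(int ^ 'n) \<Rightarrow>\<^sub>0 'k"
  proof (rule Finite_Set.bex_greatest_element)
    show "transp_on (Poly_Mapping.keys p) R" using R(1) by (rule transp_on_subset) simp
    show "totalp_on (Poly_Mapping.keys p) R" using R(2) by (rule totalp_on_subset) simp
  qed (use that in auto)
  obtain a where a: "a \<in> Poly_Mapping.keys f" "\<And>x. x \<in> Poly_Mapping.keys f \<Longrightarrow> x \<noteq> a \<Longrightarrow> R x a" using max[OF assms(1)] by blast
  obtain b where b: "b \<in> Poly_Mapping.keys g" "\<And>x. x \<in> Poly_Mapping.keys g \<Longrightarrow> x \<noteq> b \<Longrightarrow> R x b" using max[OF assms(2)] by blast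
  have uniq: "x = a \<and> y = b" if "x \<in> Poly_Mapping.keys f" "y \<in> Poly_Mapping.keys g" "a + b = x + y" for x y
  proof (rule ccontr)
    assume neq: "\<not> (x = a \<and> y = b)"
    have ne: "x \<noteq> a" "y \<noteq> b"
      using neq that(3) by (metis add_left_cancel add_right_cancel)+
    have "R (x + y) (a + y)" using a(2)[OF that(1) ne(1)] by (rule R(4))
    moreover have "R (a + y) (a + b)"
      using R(4)[OF b(2)[OF that(2) ne(2)], of a] by (simp add: add.commute)
    ultimately have "R (x + y) (a + b)" using R(1) by (blast dest: transpD)
    then show False using R(3) that(3) by (metis irreflpD)
  qed
  have inner: "Poly_Mapping.lookup f l * (\<Sum>q. Poly_Mapping.lookup g q when a + b = l + q)
      = (Poly_Mapping.lookup f a * Poly_Mapping.lookup g b when l = a)" for l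
  proof (cases "l = a")
    case True
    have "(\<Sum>q. Poly_Mapping.lookup g q when a + b = a + q) = (\<Sum>q. Poly_Mapping.lookup g q when b = q)" by simp
    then show ?thesis using True by simp
  next
    case False
    have "Poly_Mapping.lookup f l * (Poly_Mapping.lookup g q when a + b = l + q) = 0" for q
      using uniq[of l q] False by (auto simp: in_keys_iff when_def)
    then have "Poly_Mapping.lookup f l = 0 \<or> (\<forall>q. (Poly_Mapping.lookup g q when a + b = l + q) = 0)" by auto
    then show ?thesis using False by auto
  qed
  have "Poly_Mapping.lookup (f * g) (a + b) = (\<Sum>l. Poly_Mapping.lookup f a * Poly_Mapping.lookup g b when l = a)"
    unfolding lookup_mult inner ..
  also have "\<dots> = Poly_Mapping.lookup f a * Poly_Mapping.lookup g b" by simp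
  also have "\<dots> \<noteq> 0" using a(1) b(1) by (simp add: in_keys_iff)
  finally show ?thesis by auto
qed

instance laurent :: (finite, idom) idom
  by intro_classes (transfer, rule poly_mapping_vec_mult_neq_0)

section \<open>Toric varieties\<close>

text \<open>
  The coordinate ring \<open>k[\<sigma>\<^sup>\<or> \<inter> M]\<close> of the affine chart \<open>U\<^sub>\<sigma>\<close>, as a subring of \<open>k[M]\<close>.
\<close>

definition chart_ring :: "(real ^ 'n) set \<Rightarrow> ('n, 'k::field) laurent set" where
  "chart_ring \<sigma> = {f. \<forall>m\<in>support f. \<forall>w\<in>\<sigma>. 0 \<le> inner (rvec m) w}"

text \<open>
  An integral separated scheme with function field \<open>K\<close> is determined by the set of its local
  rings, as subrings of \<open>K\<close>; equality of two such sets says that the identity of \<open>K\<close> extends to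
  an isomorphism of schemes. Here \<open>K\<close> is the fraction field of \<open>k[M]\<close>.
\<close>

definition prime_ideal_of :: "'a::comm_ring_1 set \<Rightarrow> 'a set \<Rightarrow> bool" where
  "prime_ideal_of A p \<longleftrightarrow> p \<subseteq> A \<and> 0 \<in> p \<and> 1 \<notin> p \<and>
     (\<forall>x\<in>p. \<forall>y\<in>p. x + y \<in> p) \<and> (\<forall>r\<in>A. \<forall>x\<in>p. r * x \<in> p) \<and>
     (\<forall>x\<in>A. \<forall>y\<in>A. x * y \<in> p \<longrightarrow> x \<in> p \<or> y \<in> p)"

definition local_rings :: "'a::field set \<Rightarrow> 'a set set" where
  "local_rings A = {{x / y | x y. x \<in> A \<and> y \<in> A \<and> y \<notin> p} | p. prime_ideal_of A p}"

definition toric_variety :: "(real ^ 'n) set set \<Rightarrow> ('n::finite, 'k::field) laurent fract set set" where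
  "toric_variety F = (\<Union>\<sigma>\<in>F. local_rings ((\<lambda>f. Fraction_Field.Fract f 1) ` chart_ring \<sigma>))"

definition generated_algebra ::
    "('n::finite, 'k::field) laurent fract set \<Rightarrow> ('n, 'k) laurent fract set" where
  "generated_algebra S =
     (\<lambda>B. (\<forall>c. Fraction_Field.Fract (monomial 0 c) 1 \<in> B) \<and>
          (\<forall>x\<in>B. \<forall>y\<in>B. x + y \<in> B \<and> x * y \<in> B)) hull S"

text \<open>
  The closed integral subscheme of a projective space over \<open>k\<close> that is the closure of the image
  of the rational map with homogeneous coordinates \<open>S\<close> (the projective model of \<open>S\<close>); its affine
  charts are the spectra of \<open>k[t/s | t \<in> S]\<close> for \<open>0 \<noteq> s \<in> S\<close>.
\<close>

definition projective_model ::
    "('n::finite, 'k::field) laurent set \<Rightarrow> ('n, 'k) laurent fract set set" where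
  "projective_model S =
     (\<Union>s\<in>S - {0}. local_rings (generated_algebra {Fraction_Field.Fract t s | t. t \<in> S}))"

section \<open>Line bundles\<close>

text \<open>
  A quasi-coherent sheaf on the toric variety of a fan \<open>F\<close> is given by its modules of sections
  on the charts \<open>U\<^sub>\<sigma>\<close>. All sheaves needed here are subsheaves of the constant sheaf \<open>K\<close> whose
  sections on the charts lie in \<open>k[M]\<close>, the restriction maps being inclusions.
\<close>

type_synonym ('n, 'k) chart_modules = "(real ^ 'n) set \<Rightarrow> ('n, 'k) laurent set"

definition divisor_sheaf ::
    "(real ^ 'n) set set \<Rightarrow> (int ^ 'n \<Rightarrow> int) \<Rightarrow> ('n, 'k::field) chart_modules" where
  "divisor_sheaf F a \<sigma> =
     {f. \<forall>m\<in>support f. \<forall>v\<in>ray_generators F. rvec v \<in> \<sigma> \<longrightarrow> - a v \<le> pairing m v}"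

definition module_span :: "('n::finite, 'k::field) laurent set \<Rightarrow> ('n, 'k) laurent set \<Rightarrow> ('n, 'k) laurent set" where
  "module_span A S =
     (\<lambda>B. 0 \<in> B \<and> (\<forall>x\<in>B. \<forall>y\<in>B. x + y \<in> B) \<and> (\<forall>r\<in>A. \<forall>x\<in>B. r * x \<in> B)) hull S"

definition sheaf_isomorphic ::
    "(real ^ 'n) set set \<Rightarrow> ('n, 'k::field) chart_modules \<Rightarrow> ('n, 'k) chart_modules \<Rightarrow> bool" where
  "sheaf_isomorphic F L L' \<longleftrightarrow>
     (\<exists>h :: (real ^ 'n) set \<Rightarrow> ('n, 'k) laurent \<Rightarrow> ('n, 'k) laurent. \<forall>\<sigma>\<in>F.
        bij_betw (h \<sigma>) (L \<sigma>) (L' \<sigma>) \<and>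
        (\<forall>f\<in>L \<sigma>. \<forall>g\<in>L \<sigma>. h \<sigma> (f + g) = h \<sigma> f + h \<sigma> g) \<and>
        (\<forall>r\<in>chart_ring \<sigma>. \<forall>f\<in>L \<sigma>. h \<sigma> (r * f) = r * h \<sigma> f) \<and>
        (\<forall>\<tau>\<in>F. \<tau> \<subseteq> \<sigma> \<longrightarrow> (\<forall>f\<in>L \<sigma>. h \<tau> f = h \<sigma> f)))"

text \<open>
  The tensor product of two invertible submodules of \<open>K\<close> is their product.
\<close>

definition sheaf_tensor ::
    "('n::finite, 'k::field) chart_modules \<Rightarrow> ('n, 'k) chart_modules \<Rightarrow> ('n, 'k) chart_modules" where
  "sheaf_tensor L L' \<sigma> = module_span (chart_ring \<sigma>) {f * g | f g. f \<in> L \<sigma> \<and> g \<in> L' \<sigma>}"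

section \<open>Toric pairs\<close>

text \<open>
  On each chart the divisor is the divisor of a character (Fulton's T-Cartier divisors).
\<close>

definition T_Cartier :: "(real ^ 'n) set set \<Rightarrow> (int ^ 'n \<Rightarrow> int) \<Rightarrow> bool" where
  "T_Cartier F a \<longleftrightarrow>
     (\<forall>\<sigma>\<in>F. \<exists>m. \<forall>v\<in>ray_generators F. rvec v \<in> \<sigma> \<longrightarrow> a v = pairing m v)"

text \<open>
  There are finitely many global sections that generate the line bundle and define a closed
  immersion into a projective space over \<open>k\<close>, that is, an isomorphism of the toric variety (which
  is complete) with the closure of its image.
\<close>

definition very_ample ::
    "'k::field itself \<Rightarrow> (real ^ 'n) set set \<Rightarrow> (int ^ 'n \<Rightarrow> int) \<Rightarrow> bool" where
  "very_ample k F a \<longleftrightarrow>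
     (\<exists>S :: ('n, 'k) laurent set. finite S \<and>
        S \<subseteq> (\<Inter>\<sigma>\<in>F. divisor_sheaf F a \<sigma>) \<and>
        (\<forall>\<sigma>\<in>F. module_span (chart_ring \<sigma>) S = divisor_sheaf F a \<sigma>) \<and>
        toric_variety F = projective_model S)"

definition toric_pair ::
    "'k::field itself \<Rightarrow> (real ^ 'n) set set \<Rightarrow> (int ^ 'n \<Rightarrow> int) \<Rightarrow> bool" where
  "toric_pair k F a \<longleftrightarrow> complete_fan F \<and> T_Cartier F a \<and> very_ample k F a"

definition divisor_polytope ::
    "(real ^ 'n) set set \<Rightarrow> (int ^ 'n \<Rightarrow> int) \<Rightarrow> (real ^ 'n) set" where
  "divisor_polytope F a =
     {u. \<forall>v\<in>ray_generators F. - real_of_int (a v) \<le> inner u (rvec v)}"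

section \<open>The function \<open>\<phi>\<close>\<close>

definition divisor_cone ::
    "(real ^ 'n) set set \<Rightarrow> (int ^ 'n \<Rightarrow> int) \<Rightarrow> ((real ^ 'n) \<times> real) set" where
  "divisor_cone F a = convex_cone hull (divisor_polytope F a \<times> {1})"

definition unit_cube :: "int ^ 'n \<Rightarrow> (real ^ 'n) set" where
  "unit_cube v = {x. \<forall>i. real_of_int (v $ i) \<le> x $ i \<and> x $ i \<le> real_of_int (v $ i) + 1}"

definition phi_at ::
    "int ^ 'n \<Rightarrow> (real ^ 'n) set set \<Rightarrow> (int ^ 'n \<Rightarrow> int) \<Rightarrow> real \<Rightarrow> real" where
  "phi_at v F a t = measure lebesgue
     {x. (x, t + 1) \<in> unit_cube v \<times> {t + 1} -
            (\<Union>u :: int ^ 'n. (+) (rvec u, 1) ` divisor_cone F a)}"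

definition phi :: "(real ^ 'n) set set \<Rightarrow> (int ^ 'n \<Rightarrow> int) \<Rightarrow> real \<Rightarrow> real" where
  "phi = phi_at 0"

text \<open>The value does not depend on the choice of \<open>v\<close>.\<close>

lemma phi_at_eq_phi:
  fixes v :: "int ^ 'n"
  shows "phi_at v F a t = phi F a t"
proof -
  define U where "U = (\<Union>u :: int ^ 'n. (+) (rvec u, 1 :: real) ` divisor_cone F a)"
  have U: "(x + rvec w, z) \<in> U" if xz: "(x, z) \<in> U" for x z w
  proof -
    obtain u p q where "(p, q) \<in> divisor_cone F a" "x = rvec u + p" "z = 1 + q"
      using xz unfolding U_def by auto
    then have "(x + rvec w, z) \<in> (+) (rvec (u + w), 1) ` divisor_cone F a"
      by (intro image_eqI[of _ _ "(p, q)"]) (auto simp: rvec_def vec_eq_iff)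
    then show ?thesis unfolding U_def by blast
  qed
  have U_iff: "(rvec v + x, z) \<in> U \<longleftrightarrow> (x, z) \<in> U" for x z
  proof
    assume "(rvec v + x, z) \<in> U"
    then have "(rvec v + x + rvec (0 - v), z) \<in> U" by (rule U)
    moreover have "rvec v + x + rvec (0 - v) = x" by (simp add: rvec_def vec_eq_iff)
    ultimately show "(x, z) \<in> U" by metis
  next
    assume "(x, z) \<in> U"
    then show "(rvec v + x, z) \<in> U" using U[of x z v] by (simp add: add.commute)
  qed
  have cube: "rvec v + x \<in> unit_cube v \<longleftrightarrow> x \<in> unit_cube 0" for x
    by (simp add: unit_cube_def rvec_def add.commute)
  have "{x. (x, t + 1) \<in> unit_cube v \<times> {t + 1} - U}
      = (+) (rvec v) ` {x. (x, t + 1) \<in> unit_cube 0 \<times> {t + 1} - U}" (is "?A = _ ` ?B")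
  proof (intro set_eqI iffI)
    fix y assume y: "y \<in> ?A"
    then have "y = rvec v + (y - rvec v)" "y - rvec v \<in> ?B"
      using cube[of "y - rvec v"] U_iff[of "y - rvec v"] by auto
    then show "y \<in> (+) (rvec v) ` ?B" by blast
  qed (use cube U_iff in auto)
  then show ?thesis
    by (simp add: phi_def phi_at_def U_def[symmetric] measure_translation)
qed

section \<open>Segre products\<close>

definition vfst :: "'a ^ ('n::finite + 'm::finite) \<Rightarrow> 'a ^ 'n" where
  "vfst z = (\<chi> i. z $ Inl i)"

definition vsnd :: "'a ^ ('n::finite + 'm::finite) \<Rightarrow> 'a ^ 'm" where
  "vsnd z = (\<chi> j. z $ Inr j)"

definition vpair :: "'a ^ 'n \<Rightarrow> 'a ^ 'm \<Rightarrow> 'a ^ ('n::finite + 'm::finite)" where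
  "vpair x y = (\<chi> l. case l of Inl i \<Rightarrow> x $ i | Inr j \<Rightarrow> y $ j)"

text \<open>
  The fan of \<open>X \<times> Y\<close>: the charts are
  \<open>U\<^sub>\<sigma> \<times> U\<^sub>\<tau> = Spec (k[\<sigma>\<^sup>\<or> \<inter> M] \<otimes>\<^sub>k k[\<tau>\<^sup>\<or> \<inter> M']) = Spec k[(\<sigma> \<times> \<tau>)\<^sup>\<or> \<inter> (M \<oplus> M')]\<close>.
\<close>

definition product_fan ::
    "(real ^ 'n) set set \<Rightarrow> (real ^ 'm) set set \<Rightarrow> (real ^ ('n::finite + 'm::finite)) set set" where
  "product_fan F G = {{z. vfst z \<in> \<sigma> \<and> vsnd z \<in> \<tau>} | \<sigma> \<tau>. \<sigma> \<in> F \<and> \<tau> \<in> G}"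

text \<open>
  The ring homomorphisms \<open>k[M] \<rightarrow> k[M \<oplus> M']\<close> and \<open>k[M'] \<rightarrow> k[M \<oplus> M']\<close> of the projections
  \<open>\<pi>\<^sub>1\<close> and \<open>\<pi>\<^sub>2\<close>, and the pullback of a line bundle: \<open>\<pi>\<^sub>1\<close> is flat and maps the chart of
  \<open>\<rho> = \<sigma> \<times> \<tau>\<close> to that of \<open>\<sigma> = vfst ` \<rho>\<close>, so that the sections of the pullback are the
  extended module.
\<close>

definition comorphism_fst :: "('n::finite, 'k::field) laurent \<Rightarrow> ('n::finite + 'm::finite, 'k) laurent" where
  "comorphism_fst f = (\<Sum>m\<in>support f. monomial (vpair m 0) (coeff_laurent f m))"

definition comorphism_snd :: "('m::finite, 'k::field) laurent \<Rightarrow> ('n::finite + 'm::finite, 'k) laurent" where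
  "comorphism_snd f = (\<Sum>m\<in>support f. monomial (vpair 0 m) (coeff_laurent f m))"

definition pullback_fst :: "('n::finite, 'k::field) chart_modules \<Rightarrow> ('n::finite + 'm::finite, 'k) chart_modules" where
  "pullback_fst L \<rho> = module_span (chart_ring \<rho>) (comorphism_fst ` L (vfst ` \<rho>))"

definition pullback_snd :: "('m::finite, 'k::field) chart_modules \<Rightarrow> ('n::finite + 'm::finite, 'k) chart_modules" where
  "pullback_snd L \<rho> = module_span (chart_ring \<rho>) (comorphism_snd ` L (vsnd ` \<rho>))"

text \<open>
  The torus-invariant divisor \<open>e\<close> on \<open>X \<times> Y\<close> corresponds to the line bundle
  \<open>\<pi>\<^sub>1\<^sup>*\<O>(D) \<otimes> \<pi>\<^sub>2\<^sup>*\<O>(D')\<close>. This determines \<open>e\<close> only up to linear equivalence.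
\<close>

definition segre_divisor ::
    "'k::field itself \<Rightarrow> (real ^ 'n) set set \<Rightarrow> (int ^ 'n \<Rightarrow> int) \<Rightarrow>
     (real ^ 'm) set set \<Rightarrow> (int ^ 'm \<Rightarrow> int) \<Rightarrow> (int ^ ('n::finite + 'm::finite) \<Rightarrow> int) \<Rightarrow> bool" where
  "segre_divisor k F a G b e \<longleftrightarrow>
     sheaf_isomorphic (product_fan F G)
       (divisor_sheaf (product_fan F G) e :: ('n::finite + 'm::finite, 'k) chart_modules)
       (sheaf_tensor (pullback_fst (divisor_sheaf F a)) (pullback_snd (divisor_sheaf G b)))"

definition perfect_field :: "'k::field itself \<Rightarrow> bool" where
  "perfect_field k \<longleftrightarrow> (\<forall>p :: 'k poly. irreducible p \<longrightarrow> coprime p (pderiv p))"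

end

theory Submission
  imports Defs
begin

text \<open>
  The complement \<open>1 - \<phi>\<^sub>D(t)\<close> is the volume of the part of a unit cube that is covered by the
  lattice translates of \<open>t P\<^sub>D\<close>, so the formula is Fubini's theorem once \<open>P\<^sub>e\<close> is known to be an
  integral translate of the product of the two polytopes: translating a lattice-periodic set does
  not change its volume in a fundamental cube. On the torus, the chart of the cone \<open>0\<close>, the
  isomorphism of line bundles is multiplication by a unit of \<open>k[M \<oplus> M']\<close>, hence by a monomial with
  some exponent \<open>m\<close>, and so it is on every chart. On the chart of a ray \<open>v\<close>, the least value of
  \<open>\<langle>_, v\<rangle>\<close> on the exponents of sections recovers the coefficient of the divisor at \<open>v\<close>; comparing
  both sides gives \<open>e = \<pi>\<^sub>1\<^sup>*D + \<pi>\<^sub>2\<^sup>*D' + div(\<chi>\<^sup>m)\<close>.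
\<close>

section \<open>Lattice vectors\<close>

lemma vfst_vpair [simp]: "vfst (vpair x y) = x"
  and vsnd_vpair [simp]: "vsnd (vpair x y) = y"
  by (simp_all add: vfst_def vsnd_def vpair_def vec_eq_iff)

lemma vpair_vfst_vsnd [simp]: "vpair (vfst z) (vsnd z) = z"
  by (simp add: vfst_def vsnd_def vpair_def vec_eq_iff split: sum.split)

lemma vpair_eq_iff: "z = z' \<longleftrightarrow> vfst z = vfst z' \<and> vsnd z = vsnd z'"
  by (metis vpair_vfst_vsnd)

lemma vpair_zero [simp]: "vpair 0 0 = 0"
  by (simp add: vpair_def vec_eq_iff split: sum.split)

lemma vfst_zero [simp]: "vfst 0 = 0" and vsnd_zero [simp]: "vsnd 0 = 0"
  by (simp_all add: vfst_def vsnd_def vec_eq_iff)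

lemma vfst_add: "vfst (x + y) = vfst x + vfst y" and vsnd_add: "vsnd (x + y) = vsnd x + vsnd y"
  by (simp_all add: vfst_def vsnd_def vec_eq_iff)

lemma vfst_scaleR: "vfst (c *\<^sub>R x) = c *\<^sub>R vfst x" and vsnd_scaleR: "vsnd (c *\<^sub>R x) = c *\<^sub>R vsnd x"
  by (simp_all add: vfst_def vsnd_def vec_eq_iff)

lemma vfst_rvec: "vfst (rvec u) = rvec (vfst u)" and vsnd_rvec: "vsnd (rvec u) = rvec (vsnd u)"
  by (simp_all add: vfst_def vsnd_def rvec_def vec_eq_iff)

lemma rvec_vpair: "rvec (vpair u w) = vpair (rvec u) (rvec w)"
  by (simp add: vpair_eq_iff vfst_rvec vsnd_rvec)

lemma sum_UNIV_Plus:
  fixes f :: "'n::finite + 'm::finite \<Rightarrow> 'a::comm_monoid_add"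
  shows "(\<Sum>i\<in>UNIV. f i) = (\<Sum>i\<in>UNIV. f (Inl i)) + (\<Sum>i\<in>UNIV. f (Inr i))"
  using sum.Plus[of UNIV UNIV f] by (simp add: comp_def)

lemma pairing_vpair: "pairing m (vpair x y) = pairing (vfst m) x + pairing (vsnd m) y"
  by (simp add: pairing_def sum_UNIV_Plus vfst_def vsnd_def vpair_def)

lemma inner_vpair: "inner u (vpair x y) = inner (vfst u) x + inner (vsnd u) y"
  for u :: "real ^ ('n::finite + 'm::finite)"
  by (simp add: inner_vec_def sum_UNIV_Plus vfst_def vsnd_def vpair_def)

lemma inner_rvec: "inner (rvec u) (rvec v) = real_of_int (pairing u v)"
  by (simp add: inner_vec_def pairing_def rvec_def)

lemma pairing_zero_right [simp]: "pairing m 0 = 0" and pairing_zero_left [simp]: "pairing 0 v = 0"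
  by (simp_all add: pairing_def)

lemma pairing_add_left: "pairing (m + m') v = pairing m v + pairing m' v"
  by (simp add: pairing_def algebra_simps sum.distrib)

lemma rvec_zero [simp]: "rvec 0 = 0"
  by (simp add: rvec_def vec_eq_iff)

lemma rvec_add: "rvec (u + v) = rvec u + rvec v"
  by (simp add: rvec_def vec_eq_iff)

lemma rvec_eq_iff [simp]: "rvec u = rvec v \<longleftrightarrow> u = v"
  by (simp add: rvec_def vec_eq_iff)

lemma rvec_eq_0_iff [simp]: "rvec u = 0 \<longleftrightarrow> u = 0"
  by (metis rvec_eq_iff rvec_zero)

text \<open>Bezout's identity for a finite family, by induction: the new entry gets the coefficient
  \<open>p\<close> of the two-term identity, and the coefficients of the earlier entries are
  rescaled by \<open>q\<close>.\<close>

lemma ex_sum_mult_eq_Gcd: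
  fixes v :: "'a \<Rightarrow> int"
  assumes "finite A"
  shows "\<exists>u. (\<Sum>i\<in>A. u i * v i) = Gcd (v ` A)"
  using assms
proof induction
  case (insert x A)
  then obtain u where u: "(\<Sum>i\<in>A. u i * v i) = Gcd (v ` A)" by blast
  obtain p q where "p * v x + q * Gcd (v ` A) = gcd (v x) (Gcd (v ` A))"
    using bezout_int by blast
  moreover have "(\<Sum>i\<in>A. (if i = x then p else q * u i) * v i) = (\<Sum>i\<in>A. q * (u i * v i))"
    by (rule sum.cong) (use insert.hyps(2) in auto)
  ultimately have "(\<Sum>i\<in>insert x A. (if i = x then p else q * u i) * v i) = Gcd (v ` insert x A)"
    using insert.hyps u by (simp add: sum_distrib_left [symmetric])
  then show ?case by (rule exI[of _ "\<lambda>i. if i = x then p else q * u i"])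
qed simp

text \<open>Multiples of a Bezout combination take every integer value. This later supplies monomial
  sections of exactly the least order along a ray.\<close>

lemma primitive_pairing_surj:
  assumes "primitive v"
  obtains m where "pairing m v = k"
proof -
  obtain u where u: "(\<Sum>i\<in>UNIV. u i * v $ i) = 1"
    using ex_sum_mult_eq_Gcd[of UNIV "\<lambda>i. v $ i"] assms by (auto simp: primitive_def)
  have "pairing (\<chi> i. k * u i) v = k * (\<Sum>i\<in>UNIV. u i * v $ i)"
    by (simp add: pairing_def sum_distrib_left mult.assoc)
  then show thesis using u by (intro that[of "\<chi> i. k * u i"]) simp
qed

lemma primitive_nonzero: "primitive v \<Longrightarrow> v \<noteq> 0"
  by (auto simp: primitive_def)

lemma range_vpair: "range (\<lambda>i. vpair x y $ i) = range (\<lambda>i. x $ i) \<union> range (\<lambda>i. y $ i)"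
proof -
  have "range (\<lambda>i. vpair x y $ i) = (\<lambda>i. vpair x y $ i) ` (UNIV <+> UNIV)" by simp
  also have "\<dots> = range (\<lambda>i. x $ i) \<union> range (\<lambda>i. y $ i)"
    unfolding Plus_def image_Un image_image by (simp add: vpair_def)
  finally show ?thesis .
qed

lemma primitive_vpair_0 [simp]: "primitive (vpair x 0) \<longleftrightarrow> primitive x"
  and primitive_vpair_0' [simp]: "primitive (vpair 0 y) \<longleftrightarrow> primitive y"
  by (simp_all add: primitive_def range_vpair Un_commute image_constant_conv)

section \<open>Cones and fans\<close>

lemma convex_cone_hull_singleton: "convex_cone hull {x} = {c *\<^sub>R x | c. 0 \<le> c}"
  by (auto simp: convex_cone_hull_convex_hull_nonempty)

text \<open>Pairing with some \<open>u\<close> of value 1 on \<open>v\<close> shows that the ratio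
  \<open>r\<close> of \<open>w\<close> to \<open>v\<close> is an integer. It divides all coordinates
  of \<open>w\<close> and is nonnegative, so primitivity of \<open>w\<close> forces it to be
  1.\<close>

lemma primitive_in_ray_imp_eq:
  assumes "primitive v" "primitive w" "rvec w \<in> convex_cone hull {rvec v}"
  shows "w = v"
proof -
  obtain r where r: "0 \<le> r" "rvec w = r *\<^sub>R rvec v"
    using assms(3) by (auto simp: convex_cone_hull_singleton)
  obtain u where u: "pairing u v = 1" using primitive_pairing_surj[OF assms(1)] .
  have "real_of_int (pairing u w) = r"
    using u by (simp add: inner_rvec [symmetric] r(2)) (simp add: inner_rvec)
  then obtain k where k: "r = real_of_int k" by metis
  have w: "w $ i = k * v $ i" for i
    using arg_cong[OF r(2), of "\<lambda>x. x $ i"] unfolding k rvec_def by (simp flip: of_int_mult)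
  then have "k dvd Gcd (range (\<lambda>i. w $ i))" by (auto intro: Gcd_greatest)
  then have "k = 1" using assms(2) r(1) k by (simp add: primitive_def)
  then show ?thesis using w by (simp add: vec_eq_iff)
qed

text \<open>Ensures that on the chart of a ray only its own generator imposes a condition on the
  sections of a divisor sheaf.\<close>

lemma ray_generators_in_ray:
  assumes "v \<in> ray_generators F" "w \<in> ray_generators F"
  shows "rvec w \<in> convex_cone hull {rvec v} \<longleftrightarrow> w = v"
  using assms primitive_in_ray_imp_eq hull_inc[of "rvec v" "{rvec v}" convex_cone]
  by (auto simp: ray_generators_def)

lemma zero_notin_ray_generators: "v \<in> ray_generators F \<Longrightarrow> v \<noteq> 0"
  by (auto simp: ray_generators_def primitive_nonzero)

lemma fan_cone_convex_cone: "fan F \<Longrightarrow> \<sigma> \<in> F \<Longrightarrow> convex_cone \<sigma>"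
  unfolding fan_def rational_polyhedral_cone_def using convex_cone_convex_cone_hull by metis

lemma fan_cone_zero: "fan F \<Longrightarrow> \<sigma> \<in> F \<Longrightarrow> 0 \<in> \<sigma>"
  using fan_cone_convex_cone convex_cone_contains_0 by blast

text \<open>Strong convexity makes the apex an extreme point, hence a nonempty face, and a fan is
  closed under such faces. The chart of \<open>{0}\<close> is the torus.\<close>

lemma zero_cone_in_fan:
  assumes "fan F" "F \<noteq> {}"
  shows "{0} \<in> F"
proof -
  obtain \<sigma> where \<sigma>: "\<sigma> \<in> F" using assms(2) by blast
  have cone: "conic \<sigma>" "0 \<in> \<sigma>"
    using fan_cone_convex_cone[OF assms(1) \<sigma>] fan_cone_zero[OF assms(1) \<sigma>] by (auto simp: convex_cone_def)
  have "\<sigma> \<inter> uminus ` \<sigma> = {0}" using assms(1) \<sigma> by (auto simp: fan_def strongly_convex_def)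
  then have sc: "x = 0" if "x \<in> \<sigma>" "- x \<in> \<sigma>" for x
    using that by (metis IntI image_eqI minus_minus singletonD)
  have "{0} face_of \<sigma>"
    unfolding face_of_singleton extreme_point_of_def
  proof (intro conjI ballI notI)
    fix x y assume xy: "x \<in> \<sigma>" "y \<in> \<sigma>" "0 \<in> open_segment x y"
    then obtain u where u: "x \<noteq> y" "0 < u" "u < 1" "0 = (1 - u) *\<^sub>R x + u *\<^sub>R y"
      by (auto simp: in_segment)
    \<comment> \<open>If the apex were inside a segment of the cone, positive multiples of the two
      endpoints would be opposite, so both endpoints would vanish and coincide.\<close>
    have "- ((1 - u) *\<^sub>R x) = u *\<^sub>R y" using u(4) by (simp add: neg_eq_iff_add_eq_0)
    moreover have "(1 - u) *\<^sub>R x \<in> \<sigma>" "u *\<^sub>R y \<in> \<sigma>"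
      using cone(1) xy u by (auto simp: conic_def)
    ultimately have "(1 - u) *\<^sub>R x = 0" using sc by metis
    then show False using u by auto
  qed (rule cone(2))
  then show ?thesis using assms(1) \<sigma> unfolding fan_def by blast
qed

section \<open>Rays of a product fan\<close>

lemma product_cone_eqD:
  assumes "{z. vfst z \<in> \<sigma> \<and> vsnd z \<in> \<tau>} = R" "0 \<in> \<sigma>" "0 \<in> \<tau>"
  shows "\<sigma> = {x. vpair x 0 \<in> R}" "\<tau> = {y. vpair 0 y \<in> R}"
  using assms by auto

lemma ray_times_zero:
  "{z. vfst z \<in> convex_cone hull {rvec x} \<and> vsnd z \<in> {0}} = convex_cone hull {rvec (vpair x 0)}"
  "{z. vfst z \<in> {0} \<and> vsnd z \<in> convex_cone hull {rvec y}} = convex_cone hull {rvec (vpair 0 y)}"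
  by (auto simp: rvec_vpair convex_cone_hull_singleton vpair_eq_iff vfst_scaleR vsnd_scaleR)

text \<open>A product cone that contains \<open>vpair x y\<close> also contains
  \<open>vpair x 0\<close> and \<open>vpair 0 y\<close>. If it is a ray, one of \<open>x\<close> and
  \<open>y\<close> must vanish. Conversely, a ray times the zero cone of the other fan is a
  ray.\<close>

lemma ray_generators_product_fan:
  assumes F: "fan F" "F \<noteq> {}" and G: "fan G" "G \<noteq> {}"
  shows "ray_generators (product_fan F G) =
    (\<lambda>v. vpair v 0) ` ray_generators F \<union> vpair 0 ` ray_generators G" (is "?L = ?A \<union> ?B")
proof (intro equalityI subsetI)
  fix w assume "w \<in> ?L"
  then obtain \<sigma> \<tau> where st: "\<sigma> \<in> F" "\<tau> \<in> G" and w: "primitive w"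
    and eq: "{z. vfst z \<in> \<sigma> \<and> vsnd z \<in> \<tau>} = convex_cone hull {rvec w}"
    by (auto simp: ray_generators_def product_fan_def)
  define x y where "x = vfst w" and "y = vsnd w"
  have w_eq: "w = vpair x y" by (simp add: x_def y_def)
  note cones = product_cone_eqD[OF eq fan_cone_zero[OF F(1) st(1)] fan_cone_zero[OF G(1) st(2)]]
  have "rvec w \<in> {z. vfst z \<in> \<sigma> \<and> vsnd z \<in> \<tau>}" unfolding eq by (simp add: hull_inc)
  then have "vpair (rvec x) 0 \<in> convex_cone hull {rvec w}"
    "vpair 0 (rvec y) \<in> convex_cone hull {rvec w}"
    unfolding cones by (simp_all add: w_eq rvec_vpair)
  \<comment> \<open>\<open>vpair x 0\<close> is the \<open>r\<close>-fold multiple of the generator;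
    if \<open>x\<close> is nonzero, then \<open>r = 1\<close>, and the second component gives
    \<open>y = 0\<close>.\<close>
  then obtain r s where "rvec x = r *\<^sub>R rvec x" "r *\<^sub>R rvec y = 0" "rvec y = s *\<^sub>R rvec y"
    unfolding convex_cone_hull_singleton w_eq rvec_vpair
    by (auto simp: vpair_eq_iff vfst_scaleR vsnd_scaleR)
  then have "x = 0 \<or> y = 0" by auto
  then show "w \<in> ?A \<union> ?B"
  proof
    assume "y = 0"
    then have "\<sigma> = convex_cone hull {rvec x}"
      unfolding cones w_eq rvec_vpair by (auto simp: convex_cone_hull_singleton vpair_eq_iff vfst_scaleR vsnd_scaleR)
    then show ?thesis using st w w_eq \<open>y = 0\<close> by (auto simp: ray_generators_def)
  next
    assume "x = 0"
    then have "\<tau> = convex_cone hull {rvec y}"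
      unfolding cones w_eq rvec_vpair by (auto simp: convex_cone_hull_singleton vpair_eq_iff vfst_scaleR vsnd_scaleR)
    then show ?thesis using st w w_eq \<open>x = 0\<close> by (auto simp: ray_generators_def)
  qed
next
  have *: "{z. vfst z \<in> \<sigma> \<and> vsnd z \<in> \<tau>} \<in> product_fan F G" if "\<sigma> \<in> F" "\<tau> \<in> G" for \<sigma> \<tau>
    using that by (auto simp: product_fan_def)
  note *[OF _ zero_cone_in_fan[OF G], of "convex_cone hull {rvec _}", unfolded ray_times_zero]
    *[OF zero_cone_in_fan[OF F], of "convex_cone hull {rvec _}", unfolded ray_times_zero]
  moreover fix w assume "w \<in> ?A \<union> ?B"
  ultimately show "w \<in> ?L"
    by (auto simp: ray_generators_def)
qed

section \<open>Laurent polynomials\<close>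

text \<open>When no other pair of exponents sums to \<open>a + b\<close>, the convolution defining
  the coefficient collapses to a single term.\<close>

lemma coeff_mult_unique:
  fixes f g :: "('n::finite, 'k::idom) laurent"
  assumes "\<And>x y. x \<in> support f \<Longrightarrow> y \<in> support g \<Longrightarrow> x + y = a + b \<Longrightarrow> x = a \<and> y = b"
  shows "coeff_laurent (f * g) (a + b) = coeff_laurent f a * coeff_laurent g b"
proof -
  have *: "coeff_laurent f x * (\<Sum>y. coeff_laurent g y when a + b = x + y)
      = (coeff_laurent f a * coeff_laurent g b when x = a)" for x
  proof (cases "x = a")
    case True
    then have "(\<Sum>y. coeff_laurent g y when a + b = x + y) = (\<Sum>y. coeff_laurent g y when b = y)"
      by simp
    then show ?thesis using True by simp
  next
    case False
    then have "coeff_laurent f x = 0 \<or> (\<forall>y. (coeff_laurent g y when a + b = x + y) = 0)"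
      using assms[of x] by (force simp: support_def when_def)
    then show ?thesis using False by auto
  qed
  have "coeff_laurent (f * g) (a + b)
      = (\<Sum>x. coeff_laurent f x * (\<Sum>y. coeff_laurent g y when a + b = x + y))"
    by transfer (rule lookup_mult)
  also have "\<dots> = (\<Sum>x. coeff_laurent f a * coeff_laurent g b when x = a)" by (simp only: *)
  finally show ?thesis by simp
qed

lemma finite_support: "finite (support f)"
  unfolding support_def by transfer simp

lemma laurent_eqI: "(\<And>m. coeff_laurent f m = coeff_laurent g m) \<Longrightarrow> f = g"
  by transfer (rule poly_mapping_eqI)

lemma coeff_monomial: "coeff_laurent (monomial m c) m' = (if m = m' then c else 0)"
  by transfer (simp add: lookup_single when_def)

lemma support_monomial: "support (monomial m c) = (if c = 0 then {} else {m})"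
  by (auto simp: support_def coeff_monomial)

lemma one_laurent_eq: "1 = monomial 0 1"
  by transfer (simp add: single_one)

lemma support_zero [simp]: "support 0 = {}"
  unfolding support_def by transfer simp

lemma support_add: "support (f + g) \<subseteq> support f \<union> support g"
  unfolding support_def by transfer (auto simp: lookup_add)

lemma support_mult: "support (f * g) \<subseteq> {x + y | x y. x \<in> support f \<and> y \<in> support g}"
  unfolding support_def by transfer (use keys_mult in \<open>force simp: in_keys_iff\<close>)

lemma support_sum: "support (sum f A) \<subseteq> (\<Union>i\<in>A. support (f i))"
  by (induction A rule: infinite_finite_induct) (use support_add in fastforce)+

lemma support_empty_iff: "support f = {} \<longleftrightarrow> f = 0"
proof
  assume "support f = {}"
  moreover have "coeff_laurent (0 :: ('a, 'b) laurent) m = 0" for m by transfer simp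
  ultimately show "f = 0" by (intro laurent_eqI) (simp add: support_def)
qed simp

lemma support_monomial_mult:
  fixes f :: "('n::finite, 'k::idom) laurent"
  assumes "c \<noteq> 0"
  shows "support (monomial m c * f) = (+) m ` support f"
proof -
  have "coeff_laurent (monomial m c * f) (m + q) = c * coeff_laurent f q" for q
    by (subst coeff_mult_unique) (auto simp: support_monomial coeff_monomial split: if_splits)
  then have "m + q \<in> support (monomial m c * f) \<longleftrightarrow> q \<in> support f" for q
    using assms by (simp add: support_def)
  then show ?thesis
    by (metis (no_types, lifting) add_diff_cancel_left' diff_add_cancel add.commute image_iff set_eqI)
qed

lemma monomial_mult: "monomial m c * monomial m' c' = monomial (m + m') (c * c')"
  by transfer (simp add: mult_single)

text \<open>For a translation-invariant total order, the extreme exponents of a product are the sums of the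
  extreme exponents of the factors.\<close>

lemma laurent_unit_imp_monomial:
  fixes f g :: "('n::finite, 'k::idom) laurent"
  assumes "f * g = 1"
  obtains m c where "c \<noteq> 0" "f = monomial m c"
proof -
  obtain R :: "int ^ 'n \<Rightarrow> int ^ 'n \<Rightarrow> bool"
    where R: "transp R" "totalp R" "irreflp R" "\<And>x y z. R x y \<Longrightarrow> R (x + z) (y + z)"
    using ex_translation_invariant_order by blast
  have ne: "support f \<noteq> {}" "support g \<noteq> {}"
    using assms by (auto simp: support_empty_iff)
  \<comment> \<open>The coefficient at the sum of the two \<open>Q\<close>-greatest exponents is a
    nonzero product, whereas 1 has the only exponent 0. The order \<open>Q\<close> is kept arbitrary
    so that its converse yields the least exponents as well.\<close>
  have extreme: "\<exists>a\<in>support f. \<exists>b\<in>support g. a + b = 0 \<and>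
      (\<forall>x\<in>support f. x \<noteq> a \<longrightarrow> Q x a) \<and> (\<forall>x\<in>support g. x \<noteq> b \<longrightarrow> Q x b)"
    if Q: "transp Q" "totalp Q" "irreflp Q" "\<And>x y z. Q x y \<Longrightarrow> Q (x + z) (y + z)" for Q
  proof -
    have max: "\<exists>a\<in>A. \<forall>x\<in>A. x \<noteq> a \<longrightarrow> Q x a" if "finite A" "A \<noteq> {}" for A
      using that Q(1,2) by (intro Finite_Set.bex_greatest_element) (auto intro: transp_on_subset totalp_on_subset)
    obtain a where a: "a \<in> support f" "\<And>x. x \<in> support f \<Longrightarrow> x \<noteq> a \<Longrightarrow> Q x a"
      using max[OF finite_support ne(1)] by blast
    obtain b where b: "b \<in> support g" "\<And>x. x \<in> support g \<Longrightarrow> x \<noteq> b \<Longrightarrow> Q x b"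
      using max[OF finite_support ne(2)] by blast
    have "coeff_laurent (f * g) (a + b) = coeff_laurent f a * coeff_laurent g b"
    proof (rule coeff_mult_unique, rule ccontr)
      fix x y assume xy: "x \<in> support f" "y \<in> support g" "x + y = a + b" and "\<not> (x = a \<and> y = b)"
      then have "x \<noteq> a" "y \<noteq> b" by auto
      then have "Q (x + y) (a + y)" "Q (y + a) (b + a)"
        using Q(4)[OF a(2)[OF xy(1)]] Q(4)[OF b(2)[OF xy(2)]] by blast+
      then show False using Q(1,3) xy(3) by (metis add.commute irreflpD transpD)
    qed
    also have "\<dots> \<noteq> 0" using a(1) b(1) by (simp add: support_def)
    finally have "a + b = 0" unfolding assms one_laurent_eq by (simp add: coeff_monomial split: if_splits)
    then show ?thesis using a b by blast
  qed
  obtain a b where ab: "a \<in> support f" "b \<in> support g" "a + b = 0"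
    "\<And>x. x \<in> support f \<Longrightarrow> x \<noteq> a \<Longrightarrow> R x a" "\<And>x. x \<in> support g \<Longrightarrow> x \<noteq> b \<Longrightarrow> R x b"
    using extreme[OF R] by blast
  obtain a' b' where ab': "a' \<in> support f" "b' \<in> support g" "a' + b' = 0"
    "\<And>x. x \<in> support f \<Longrightarrow> x \<noteq> a' \<Longrightarrow> R a' x" "\<And>x. x \<in> support g \<Longrightarrow> x \<noteq> b' \<Longrightarrow> R b' x"
    using extreme[of "R\<inverse>\<inverse>"] R by auto
  \<comment> \<open>Otherwise both least exponents lie strictly below the greatest ones, and adding
    up gives 0 strictly below 0.\<close>
  have "a' = a"
  proof (rule ccontr)
    assume "a' \<noteq> a"
    then have "R a' a" "b' \<noteq> b" using ab(3,4) ab'(1,3) by (auto simp: add_eq_0_iff2)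
    then have "R (a' + b') (a + b')" "R (b' + a) (b + a)" using R(4) ab(5) ab'(2) by auto
    then show False using R(1,3) ab(3) ab'(3) by (metis add.commute irreflpD transpD)
  qed
  then have "x = a" if "x \<in> support f" for x
    using that ab(4) ab'(4) R(1,3) by (metis irreflpD transpD)
  then have "support f = {a}" using ab(1) by blast
  then have "f = monomial a (coeff_laurent f a)" "coeff_laurent f a \<noteq> 0"
    by (auto intro!: laurent_eqI simp: coeff_monomial support_def)
  then show thesis using that by blast
qed

text \<open>For a ray generator \<open>v\<close>, these are the functions on the torus of order at
  least \<open>k\<close> along the divisor of \<open>v\<close>. Allowing \<open>v = 0\<close>
  includes the torus chart, where \<open>above 0 0\<close> is the whole ring.\<close>

definition above :: "int ^ 'n \<Rightarrow> int \<Rightarrow> ('n::finite, 'k::field) laurent set" where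
  "above v k = {f. \<forall>m\<in>support f. k \<le> pairing m v}"

lemma above_zero: "above 0 0 = UNIV"
  by (simp add: above_def)

lemma above_add: "f \<in> above v k \<Longrightarrow> g \<in> above v k \<Longrightarrow> f + g \<in> above v k"
  using support_add unfolding above_def by blast

lemma above_mult: "f \<in> above v k \<Longrightarrow> g \<in> above v l \<Longrightarrow> f * g \<in> above v (k + l)"
  using support_mult[of f g] by (fastforce simp: above_def pairing_add_left)

lemma monomial_in_above: "c \<noteq> 0 \<Longrightarrow> monomial m c \<in> above v k \<longleftrightarrow> k \<le> pairing m v"
  by (simp add: above_def support_monomial)

lemma monomial_mult_in_above:
  "c \<noteq> 0 \<Longrightarrow> monomial m c * f \<in> above v k \<longleftrightarrow> f \<in> above v (k - pairing m v)"
  by (auto simp: above_def support_monomial_mult pairing_add_left)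

section \<open>Comparing the line bundles\<close>

lemma chart_ring_subset_above:
  assumes "rvec v \<in> \<sigma>"
  shows "chart_ring \<sigma> \<subseteq> above v 0"
proof
  fix f assume "f \<in> chart_ring \<sigma>"
  then have "0 \<le> inner (rvec m) (rvec v)" if "m \<in> support f" for m
    using assms that by (auto simp: chart_ring_def)
  then show "f \<in> above v 0" by (simp add: above_def inner_rvec)
qed

text \<open>Regular functions on a chart containing \<open>v\<close> have order at least 0 along
  \<open>v\<close>, so \<open>above v k\<close> is a module over the chart ring and contains the
  span of any of its subsets.\<close>

lemma module_span_subset_above:
  assumes "rvec v \<in> \<sigma>" "S \<subseteq> above v k"
  shows "module_span (chart_ring \<sigma>) S \<subseteq> above v k"
  unfolding module_span_def
proof (rule hull_minimal)
  show "0 \<in> above v k \<and> (\<forall>x\<in>above v k. \<forall>y\<in>above v k. x + y \<in> above v k) \<and>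
      (\<forall>r\<in>chart_ring \<sigma>. \<forall>x\<in>above v k. r * x \<in> above v k)"
    using chart_ring_subset_above[OF assms(1)]
    by (intro conjI ballI above_add above_mult[of _ v 0 _ k, simplified]) (auto simp: above_def)
qed (rule assms(2))

lemma module_span_inc: "f \<in> S \<Longrightarrow> f \<in> module_span A S"
  unfolding module_span_def by (rule hull_inc)

lemma module_span_mult:
  assumes "r \<in> A" "f \<in> S"
  shows "r * f \<in> module_span A S"
  using assms unfolding module_span_def hull_def by auto

lemma comorphism_fst_monomial: "c \<noteq> 0 \<Longrightarrow> comorphism_fst (monomial m c) = monomial (vpair m 0) c"
  and comorphism_snd_monomial: "c \<noteq> 0 \<Longrightarrow> comorphism_snd (monomial m c) = monomial (vpair 0 m) c"
  by (simp_all add: comorphism_fst_def comorphism_snd_def support_monomial coeff_monomial)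

lemma comorphism_fst_above: "f \<in> above (vfst v) k \<Longrightarrow> comorphism_fst f \<in> above v k"
  using support_sum[of "\<lambda>m. monomial (vpair m 0) (coeff_laurent f m)" "support f"]
    pairing_vpair[of _ "vfst v" "vsnd v"]
  by (fastforce simp: above_def comorphism_fst_def support_monomial split: if_splits)

lemma comorphism_snd_above: "f \<in> above (vsnd v) k \<Longrightarrow> comorphism_snd f \<in> above v k"
  using support_sum[of "\<lambda>m. monomial (vpair 0 m) (coeff_laurent f m)" "support f"]
    pairing_vpair[of _ "vfst v" "vsnd v"]
  by (fastforce simp: above_def comorphism_snd_def support_monomial split: if_splits)

context
  fixes \<sigma> :: "(real ^ 'n::finite) set" and \<tau> :: "(real ^ 'm::finite) set" and \<rho>
  assumes \<rho>: "\<rho> = {z. vfst z \<in> \<sigma> \<and> vsnd z \<in> \<tau>}"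
    and ne: "0 \<in> \<sigma>" "0 \<in> \<tau>"
begin

text \<open>Each projection recovers its factor because the other factor is nonempty; this
  identifies the charts from which the pullbacks are extended.\<close>

lemma vfst_image_product: "vfst ` \<rho> = \<sigma>" and vsnd_image_product: "vsnd ` \<rho> = \<tau>"
  using ne by (force simp: \<rho> image_iff intro: exI[of _ "vpair _ _"])+

text \<open>A lower bound for the order of sections of the tensor product: comorphisms preserve
  orders along the matching component, and orders add under multiplication.\<close>

lemma sheaf_tensor_subset_above:
  assumes "rvec v \<in> \<sigma>" "rvec w \<in> \<tau>" "L \<sigma> \<subseteq> above v k" "L' \<tau> \<subseteq> above w l"
  shows "sheaf_tensor (pullback_fst L) (pullback_snd L') \<rho> \<subseteq> above (vpair v w) (k + l)"
proof -
  have *: "rvec (vpair v w) \<in> \<rho>" using assms(1,2) by (simp add: \<rho> rvec_vpair)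
  have "pullback_fst L \<rho> \<subseteq> above (vpair v w) k" "pullback_snd L' \<rho> \<subseteq> above (vpair v w) l"
    unfolding pullback_fst_def pullback_snd_def vfst_image_product vsnd_image_product
    using assms(3,4)
    by (intro module_span_subset_above[OF *]; force intro!: comorphism_fst_above comorphism_snd_above)+
  then show ?thesis
    unfolding sheaf_tensor_def by (intro module_span_subset_above[OF *]) (auto intro!: above_mult)
qed

text \<open>With \<open>r = 1\<close> and monomials of least order, this shows that the preceding
  bound is attained. The free factor \<open>r\<close> makes the sections over the torus the whole
  ring.\<close>

lemma monomial_in_sheaf_tensor:
  fixes L :: "('n, 'k::field) chart_modules" and L' :: "('m, 'k) chart_modules"
  assumes "monomial m 1 \<in> L \<sigma>" "monomial m' 1 \<in> L' \<tau>"
    and r: "r \<in> chart_ring \<rho>"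
  shows "r * monomial (vpair m m') 1 \<in> sheaf_tensor (pullback_fst L) (pullback_snd L') \<rho>"
proof -
  have "monomial (vpair m 0) 1 \<in> pullback_fst L \<rho>" "monomial (vpair 0 m') 1 \<in> pullback_snd L' \<rho>"
    unfolding pullback_fst_def pullback_snd_def vfst_image_product vsnd_image_product
    using assms(1,2) by (auto intro!: module_span_inc simp flip: comorphism_fst_monomial comorphism_snd_monomial)
  moreover have "vpair m m' = vpair m 0 + vpair 0 m'"
    by (simp add: vpair_eq_iff[of "vpair m m'"] vfst_add vsnd_add)
  then have "monomial (vpair m m') 1 = monomial (vpair m 0) 1 * monomial (vpair 0 m') (1 :: 'k)"
    by (simp add: monomial_mult)
  ultimately show ?thesis
    unfolding sheaf_tensor_def by (intro module_span_mult[OF r]) blast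
qed

end

lemma divisor_sheaf_ray:
  assumes "v \<in> ray_generators F"
  shows "divisor_sheaf F a (convex_cone hull {rvec v}) = above v (- a v)"
  using ray_generators_in_ray[OF assms] assms by (auto simp: divisor_sheaf_def above_def)

lemma divisor_sheaf_zero: "divisor_sheaf F a {0} = UNIV"
  using zero_notin_ray_generators by (fastforce simp: divisor_sheaf_def)

text \<open>Over the torus both sheaves are all of \<open>k[M]\<close>, so linearity makes
  \<open>h {0}\<close> multiplication by \<open>h {0} 1\<close>. Surjectivity makes that element a
  unit, hence a monomial. Every chart restricts to the torus by inclusion, so the same monomial
  describes \<open>h\<close> everywhere.\<close>

lemma sheaf_isomorphic_imp_mult_monomial:
  fixes L L' :: "('n::finite, 'k::field) chart_modules"
  assumes iso: "sheaf_isomorphic F L L'"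
    and zero: "{0} \<in> F" "L {0} = UNIV" "L' {0} = UNIV" "\<And>\<sigma>. \<sigma> \<in> F \<Longrightarrow> 0 \<in> \<sigma>"
  obtains m c where "c \<noteq> 0" "\<And>\<sigma>. \<sigma> \<in> F \<Longrightarrow> L' \<sigma> = (*) (monomial m c) ` L \<sigma>"
proof -
  obtain h where h: "\<And>\<sigma>. \<sigma> \<in> F \<Longrightarrow> bij_betw (h \<sigma>) (L \<sigma>) (L' \<sigma>)"
    "\<And>\<sigma> r f. \<sigma> \<in> F \<Longrightarrow> r \<in> chart_ring \<sigma> \<Longrightarrow> f \<in> L \<sigma> \<Longrightarrow> h \<sigma> (r * f) = r * h \<sigma> f"
    "\<And>\<sigma> \<tau> f. \<sigma> \<in> F \<Longrightarrow> \<tau> \<in> F \<Longrightarrow> \<tau> \<subseteq> \<sigma> \<Longrightarrow> f \<in> L \<sigma> \<Longrightarrow> h \<tau> f = h \<sigma> f"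
  proof -
    from iso obtain h :: "(real ^ 'n) set \<Rightarrow> ('n, 'k) laurent \<Rightarrow> ('n, 'k) laurent"
      where h: "\<forall>\<sigma>\<in>F. bij_betw (h \<sigma>) (L \<sigma>) (L' \<sigma>) \<and>
        (\<forall>f\<in>L \<sigma>. \<forall>g\<in>L \<sigma>. h \<sigma> (f + g) = h \<sigma> f + h \<sigma> g) \<and>
        (\<forall>r\<in>chart_ring \<sigma>. \<forall>f\<in>L \<sigma>. h \<sigma> (r * f) = r * h \<sigma> f) \<and>
        (\<forall>\<tau>\<in>F. \<tau> \<subseteq> \<sigma> \<longrightarrow> (\<forall>f\<in>L \<sigma>. h \<tau> f = h \<sigma> f))"
      unfolding sheaf_isomorphic_def ..
    show thesis by (rule that[of h]) (use h in blast)+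
  qed
  have h0: "h {0} f = h {0} 1 * f" for f
  proof -
    have "f \<in> chart_ring {0}" by (simp add: chart_ring_def)
    from h(2)[OF zero(1) this, of 1] show ?thesis unfolding zero(2) by (metis UNIV_I mult.commute mult_1_right)
  qed
  have "1 \<in> h {0} ` L {0}" using h(1)[OF zero(1)] zero(3) by (simp add: bij_betw_def)
  then obtain g where "h {0} g = 1" by (metis imageE)
  then have "h {0} 1 * g = 1" using h0[of g] by simp
  then obtain m c where mc: "c \<noteq> 0" "h {0} 1 = monomial m c" by (rule laurent_unit_imp_monomial)
  have "L' \<sigma> = (*) (monomial m c) ` L \<sigma>" if "\<sigma> \<in> F" for \<sigma>
  proof -
    have "h \<sigma> f = monomial m c * f" if "f \<in> L \<sigma>" for f
      using h(3)[OF \<open>\<sigma> \<in> F\<close> zero(1) _ that] zero(4)[OF \<open>\<sigma> \<in> F\<close>] h0[of f] mc(2) by simp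
    then have "h \<sigma> ` L \<sigma> = (*) (monomial m c) ` L \<sigma>" by (rule image_cong[OF refl])
    then show ?thesis using h(1)[OF that] by (simp add: bij_betw_def)
  qed
  then show thesis using mc(1) that by blast
qed

proposition segre_divisor_linearly_equivalent:
  fixes F :: "(real ^ 'n::finite) set set" and G :: "(real ^ 'm::finite) set set"
  assumes F: "fan F" "F \<noteq> {}" and G: "fan G" "G \<noteq> {}"
    and e: "segre_divisor TYPE('k::field) F a G b e"
  obtains m where "\<And>v. v \<in> ray_generators F \<Longrightarrow> e (vpair v 0) = a v + pairing m (vpair v 0)"
    "\<And>w. w \<in> ray_generators G \<Longrightarrow> e (vpair 0 w) = b w + pairing m (vpair 0 w)"
proof -
  let ?P = "product_fan F G"
  let ?L = "divisor_sheaf F a :: ('n, 'k) chart_modules"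
  let ?L' = "divisor_sheaf G b :: ('m, 'k) chart_modules"
  let ?T = "sheaf_tensor (pullback_fst ?L) (pullback_snd ?L')"
  note F0 = zero_cone_in_fan[OF F] and G0 = zero_cone_in_fan[OF G]
  have zero_eq: "{0} = {z. vfst z \<in> {0 :: real ^ 'n} \<and> vsnd z \<in> {0 :: real ^ 'm}}"
    by (auto simp: vpair_eq_iff)
  have P0: "{0} \<in> ?P" unfolding product_fan_def using F0 G0 zero_eq by blast
  \<comment> \<open>The exponent 0 on both factors gives the section 1, and its multiples by
    arbitrary \<open>r\<close> exhaust the ring.\<close>
  have T0: "?T {0} = UNIV"
    using monomial_in_sheaf_tensor[OF zero_eq, of 0 ?L 0 ?L']
    by (auto simp: divisor_sheaf_zero chart_ring_def one_laurent_eq [symmetric])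
  have "0 \<in> \<rho>" if "\<rho> \<in> ?P" for \<rho>
    using that fan_cone_zero[OF F(1)] fan_cone_zero[OF G(1)] by (auto simp: product_fan_def)
  then obtain m and c :: 'k where c: "c \<noteq> 0"
    and T: "\<And>\<rho>. \<rho> \<in> ?P \<Longrightarrow> ?T \<rho> = (*) (monomial m c) ` divisor_sheaf ?P e \<rho>"
    using sheaf_isomorphic_imp_mult_monomial[OF e[unfolded segre_divisor_def] P0 divisor_sheaf_zero T0] by metis
  \<comment> \<open>The least order along the ray is \<open>k + l\<close> for the tensor product and
    \<open>- e (vpair v w)\<close> for the divisor sheaf; multiplication by the monomial shifts the
    latter by \<open>pairing m (vpair v w)\<close>. Keeping both \<open>v\<close> and
    \<open>w\<close> general treats the two kinds of rays at once.\<close>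
  have main: "e (vpair v w) = pairing m (vpair v w) - (k + l)"
    if V: "vpair v w \<in> ray_generators ?P" and cone: "\<sigma> \<in> F" "\<tau> \<in> G"
      "{z. vfst z \<in> \<sigma> \<and> vsnd z \<in> \<tau>} = convex_cone hull {rvec (vpair v w)}"
      and L: "?L \<sigma> \<subseteq> above v k" "monomial x 1 \<in> ?L \<sigma>" "pairing x v = k"
      and L': "?L' \<tau> \<subseteq> above w l" "monomial y 1 \<in> ?L' \<tau>" "pairing y w = l"
    for v w \<sigma> \<tau> k l x y
  proof (rule antisym)
    note \<rho> = cone(3)[symmetric] fan_cone_zero[OF F(1) cone(1)] fan_cone_zero[OF G(1) cone(2)]
    let ?V = "vpair v w" and ?\<rho> = "convex_cone hull {rvec (vpair v w)}"
    have *: "?T ?\<rho> = (*) (monomial m c) ` above ?V (- e ?V)"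
      using T[of ?\<rho>] V unfolding divisor_sheaf_ray[OF V] by (simp add: ray_generators_def)
    have "rvec ?V \<in> ?\<rho>" by (simp add: hull_inc)
    then have "rvec v \<in> \<sigma>" "rvec w \<in> \<tau>" unfolding cone(3)[symmetric] by (simp_all add: rvec_vpair)
    then have sub: "?T ?\<rho> \<subseteq> above ?V (k + l)"
      using sheaf_tensor_subset_above[OF \<rho>, where L = ?L and L' = ?L'] L(1) L'(1) by blast
    \<comment> \<open>A section of the divisor sheaf of exactly the least order; its image must
      respect the bound on the tensor product.\<close>
    obtain q where q: "pairing q ?V = - e ?V"
      using V primitive_pairing_surj by (auto simp: ray_generators_def)
    have "monomial m c * monomial q 1 \<in> ?T ?\<rho>"
      unfolding * by (rule imageI) (simp add: monomial_in_above q)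
    then have "monomial (m + q) c \<in> (above ?V (k + l) :: ('n + 'm, 'k) laurent set)"
      using sub by (auto simp: monomial_mult)
    then show "e ?V \<le> pairing m ?V - (k + l)"
      using q c by (simp add: monomial_in_above pairing_add_left)
    \<comment> \<open>Conversely, a section of the tensor product of order exactly
      \<open>k + l\<close>, which must come from a section of the divisor sheaf.\<close>
    have "1 * monomial (vpair x y) 1 \<in> ?T ?\<rho>"
      by (rule monomial_in_sheaf_tensor[OF \<rho>, where L = ?L and L' = ?L'])
        (use L L' in \<open>auto simp: chart_ring_def one_laurent_eq support_monomial\<close>)
    then have "(monomial (vpair x y) 1 :: ('n + 'm, 'k) laurent) \<in> above ?V (- e ?V + pairing m ?V)"
      unfolding * using monomial_mult_in_above[OF c] by fastforce
    then show "pairing m ?V - (k + l) \<le> e ?V"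
      using L(3) L'(3) by (simp add: monomial_in_above pairing_vpair)
  qed
  note rays = ray_generators_product_fan[OF F G]
  show thesis
  proof (rule that)
    fix v assume v: "v \<in> ray_generators F"
    obtain x where "pairing x v = - a v" using v primitive_pairing_surj by (auto simp: ray_generators_def)
    \<comment> \<open>The second factor is the torus chart, where the order along the zero vector is
      0 and the exponent 0 serves as witness.\<close>
    then have "e (vpair v 0) = pairing m (vpair v 0) - (- a v + 0)"
      using v G0 rays
      by (intro main[OF _ _ _ ray_times_zero(1), where x = x and y = 0])
        (auto simp: divisor_sheaf_ray divisor_sheaf_zero monomial_in_above above_zero
          ray_generators_def)
    then show "e (vpair v 0) = a v + pairing m (vpair v 0)" by simp
  next
    fix w assume w: "w \<in> ray_generators G"
    obtain y where "pairing y w = - b w" using w primitive_pairing_surj by (auto simp: ray_generators_def)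
    then have "e (vpair 0 w) = pairing m (vpair 0 w) - (0 + - b w)"
      using w F0 rays
      by (intro main[OF _ _ _ ray_times_zero(2), where x = 0 and y = y])
        (auto simp: divisor_sheaf_ray divisor_sheaf_zero monomial_in_above above_zero
          ray_generators_def)
    then show "e (vpair 0 w) = b w + pairing m (vpair 0 w)" by simp
  qed
qed

section \<open>Volumes in a fundamental cube\<close>

text \<open>The fibres are half-open unit cubes, which tile space without overlaps, unlike the
  closed cubes of \<open>unit_cube\<close>.\<close>

definition vfloor :: "real ^ 'n \<Rightarrow> int ^ 'n" where
  "vfloor x = (\<chi> i. \<lfloor>x $ i\<rfloor>)"

lemma vfloor_rvec_add: "vfloor (rvec u + x) = u + vfloor x"
  by (simp add: vfloor_def rvec_def vec_eq_iff)

lemma borel_vfloor_vimage: "{x :: real ^ 'n::finite. vfloor (x + c) = u} \<in> sets borel"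
proof -
  have [measurable]: "(\<lambda>x :: real ^ 'n. x $ i) \<in> borel_measurable borel" for i
    by (intro borel_measurable_continuous_onI continuous_intros)
  have "{x. vfloor (x + c) = u} = {x. \<forall>i. \<lfloor>x $ i + c $ i\<rfloor> = u $ i}"
    by (simp add: vfloor_def vec_eq_iff)
  also have "\<dots> \<in> sets borel" by measurable
  finally show ?thesis .
qed

lemma emeasure_lborel_translation:
  fixes S :: "'a::euclidean_space set"
  assumes "S \<in> sets borel"
  shows "emeasure lborel {x. c + x \<in> S} = emeasure lborel S"
proof -
  have "emeasure lborel S = emeasure (distr lborel borel ((+) c)) S"
    by (simp add: lborel_distr_plus)
  also have "\<dots> = emeasure lborel ((+) c -` S \<inter> space lborel)"
    using assms by (intro emeasure_distr) auto
  finally show ?thesis by (simp add: vimage_def)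
qed

text \<open>The offset \<open>c\<close> shifts the tiling, since the translation argument below cuts
  along two different tilings.\<close>

lemma emeasure_vfloor_decompose:
  fixes S :: "(real ^ 'n::finite) set"
  assumes "S \<in> sets borel"
  shows "emeasure lborel S = (\<integral>\<^sup>+u. emeasure lborel (S \<inter> {x. vfloor (x + c) = u}) \<partial>count_space UNIV)"
proof -
  have "emeasure lborel S = emeasure lborel (\<Union>u. S \<inter> {x. vfloor (x + c) = u})"
    by (rule arg_cong[where f = "emeasure lborel"]) auto
  also have "\<dots> = (\<integral>\<^sup>+u. emeasure lborel (S \<inter> {x. vfloor (x + c) = u}) \<partial>count_space UNIV)"
    using assms borel_vfloor_vimage by (intro emeasure_UN_countable) (auto simp: disjoint_family_on_def)
  finally show ?thesis .
qed

text \<open>Cutting both sides into lattice translates of pieces of the fundamental cube matches the pieces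
  up to the involution \<open>u \<mapsto> - u\<close>.\<close>

lemma emeasure_fundamental_cube_translation:
  fixes S :: "(real ^ 'n::finite) set"
  assumes S: "S \<in> sets borel" and per: "\<And>u x. rvec u + x \<in> S \<longleftrightarrow> x \<in> S"
  shows "emeasure lborel {x. vfloor x = 0 \<and> x + c \<in> S} = emeasure lborel {x. vfloor x = 0 \<and> x \<in> S}"
proof -
  let ?C = "\<lambda>c u. {x :: real ^ 'n. vfloor (x + c) = u}"
  have [measurable]: "S \<in> sets borel" "\<And>c u. ?C c u \<in> sets borel"
    using S borel_vfloor_vimage by auto
  have C0: "?C 0 u = {x. vfloor x = u}" for u by simp
  have "emeasure lborel {x. vfloor x = 0 \<and> x + c \<in> S} = emeasure lborel {x. c + x \<in> S \<inter> ?C (- c) 0}"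
    by (simp add: add.commute conj_commute)
  also have "\<dots> = emeasure lborel (S \<inter> ?C (- c) 0)"
    by (rule emeasure_lborel_translation) measurable
  also have "\<dots> = (\<integral>\<^sup>+u. emeasure lborel (S \<inter> ?C (- c) 0 \<inter> ?C 0 u) \<partial>count_space UNIV)"
    by (rule emeasure_vfloor_decompose) measurable
  also have "\<dots> = (\<integral>\<^sup>+u. emeasure lborel (S \<inter> ?C 0 0 \<inter> ?C (- c) (- u)) \<partial>count_space UNIV)"
  proof (rule nn_integral_cong)
    fix u
    have "emeasure lborel (S \<inter> ?C (- c) 0 \<inter> ?C 0 u)
        = emeasure lborel {x. rvec u + x \<in> S \<inter> ?C (- c) 0 \<inter> ?C 0 u}"
      by (rule emeasure_lborel_translation [symmetric]) measurable
    \<comment> \<open>Translation by the lattice vector moves cube \<open>u\<close> of the standard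
      tiling to cube 0, and cube 0 of the shifted tiling to cube \<open>- u\<close>; periodicity
      keeps \<open>S\<close> fixed.\<close>
    also have "{x. rvec u + x \<in> S \<inter> ?C (- c) 0 \<inter> ?C 0 u} = S \<inter> ?C 0 0 \<inter> ?C (- c) (- u)"
      using vfloor_rvec_add[of u "_ - c"]
      by (auto simp: per vfloor_rvec_add add_diff_eq add_eq_0_iff)
    finally show "emeasure lborel (S \<inter> ?C (- c) 0 \<inter> ?C 0 u)
        = emeasure lborel (S \<inter> ?C 0 0 \<inter> ?C (- c) (- u))" .
  qed
  also have "\<dots> = (\<integral>\<^sup>+u. emeasure lborel (S \<inter> ?C 0 0 \<inter> ?C (- c) u) \<partial>count_space UNIV)"
    by (rule nn_integral_bij_count_space) (rule bij_uminus)
  also have "\<dots> = emeasure lborel (S \<inter> ?C 0 0)"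
    by (rule emeasure_vfloor_decompose [symmetric]) measurable
  finally show ?thesis by (simp add: Int_def conj_commute)
qed

lemma unit_cube_0: "unit_cube 0 = (cbox 0 1 :: (real ^ 'n::finite) set)"
  by (auto simp: unit_cube_def mem_box_cart)

lemma measure_unit_cube: "measure lborel (unit_cube 0 :: (real ^ 'n::finite) set) = 1"
proof -
  have "(cbox 0 1 :: (real ^ 'n) set) \<noteq> {}" by (simp add: interval_ne_empty_cart)
  then show ?thesis unfolding unit_cube_0 by (subst content_cbox_cart) auto
qed

text \<open>The closed and the half-open cube differ only inside the frontier of a box, which is a
  null set.\<close>

lemma measure_unit_cube_Int:
  fixes S :: "(real ^ 'n::finite) set"
  assumes "S \<in> sets borel"
  shows "measure lborel (unit_cube 0 \<inter> S) = measure lborel {x. vfloor x = 0 \<and> x \<in> S}"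
proof -
  let ?Q = "{x. vfloor x = 0 \<and> x \<in> S}"
  have Q: "?Q = {x. vfloor (x + 0) = 0} \<inter> S" by auto
  have [measurable]: "?Q \<in> sets borel" unfolding Q using assms borel_vfloor_vimage by blast
  have cube: "x \<in> box 0 1 \<Longrightarrow> vfloor x = 0" "vfloor x = 0 \<Longrightarrow> x \<in> cbox 0 1" for x :: "real ^ 'n"
    by (auto simp: vfloor_def mem_box_cart vec_eq_iff floor_eq_iff less_imp_le)
  have "negligible (unit_cube 0 \<inter> S - ?Q \<union> (?Q - unit_cube 0 \<inter> S))"
    by (rule negligible_subset[OF negligible_frontier_interval[of 0 1]]) (use cube in \<open>auto simp: unit_cube_0\<close>)
  moreover have "unit_cube 0 \<inter> S \<in> lmeasurable"
    unfolding unit_cube_0 using assms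
    by (intro bounded_set_imp_lmeasurable bounded_Int) auto
  ultimately have "measure lebesgue ?Q = measure lebesgue (unit_cube 0 \<inter> S)"
    by (intro measure_negligible_symdiff)
  then show ?thesis using assms by (simp add: unit_cube_0 measure_completion)
qed

text \<open>Absorbs the translation of the polytope that comes from knowing \<open>e\<close> only up
  to linear equivalence.\<close>

lemma measure_unit_cube_Int_translation:
  fixes S :: "(real ^ 'n::finite) set"
  assumes S: "S \<in> sets borel" and per: "\<And>u x. rvec u + x \<in> S \<longleftrightarrow> x \<in> S"
  shows "measure lborel (unit_cube 0 \<inter> {x. x + c \<in> S}) = measure lborel (unit_cube 0 \<inter> S)"
proof -
  have "{x. x + c \<in> S} = (\<lambda>x. x + c) -` S \<inter> space borel" by auto
  also have "\<dots> \<in> sets borel" using S by (intro measurable_sets) auto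
  finally show ?thesis
    using emeasure_fundamental_cube_translation[OF assms, of c]
    by (simp add: measure_unit_cube_Int S) (simp add: measure_def)
qed

section \<open>Lebesgue measure on a product of coordinate spaces\<close>

lemma borel_measurable_vpair:
  "(\<lambda>p :: (real ^ 'n::finite) \<times> (real ^ 'm::finite). vpair (fst p) (snd p))
    \<in> borel_measurable (lborel \<Otimes>\<^sub>M lborel)"
proof -
  have "linear (\<lambda>p :: (real ^ 'n) \<times> (real ^ 'm). vpair (fst p) (snd p))"
    by (rule linearI) (simp_all add: vpair_eq_iff[of "vpair _ _"] vfst_add vsnd_add vfst_scaleR vsnd_scaleR)
  then show ?thesis
    by (simp add: lborel_prod borel_measurable_continuous_onI linear_continuous_on linear_conv_bounded_linear)
qed

lemma prod_Basis_vec: "(\<Prod>b\<in>Basis. x \<bullet> b) = (\<Prod>i\<in>UNIV. (x :: real ^ 'n::finite) $ i)"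
proof -
  have Basis: "(Basis :: (real ^ 'n) set) = range (\<lambda>i. axis i 1)" by (auto simp: Basis_vec_def)
  have "inj (\<lambda>i :: 'n. axis i (1 :: real))" by (auto simp: inj_on_def axis_eq_axis)
  then show ?thesis unfolding Basis by (simp add: prod.reindex inner_axis)
qed

text \<open>Lebesgue measure is determined by its values on boxes, and \<open>vpair\<close> pulls a
  box back to a product of two boxes with the same edge lengths. This carries product measure over
  to vectors indexed by a sum type.\<close>

lemma lborel_vpair:
  "lborel = distr (lborel \<Otimes>\<^sub>M lborel) borel (\<lambda>p :: (real ^ 'n::finite) \<times> (real ^ 'm::finite). vpair (fst p) (snd p))"
    (is "_ = distr _ _ ?f")
proof (rule lborel_eqI)
  fix l u :: "real ^ ('n + 'm)"
  assume le: "\<And>b. b \<in> Basis \<Longrightarrow> l \<bullet> b \<le> u \<bullet> b"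
  have le': "l $ i \<le> u $ i" for i
    using le[of "axis i 1"] by (simp add: inner_axis axis_in_Basis_iff)
  have box: "emeasure lborel (box a b) = ennreal (\<Prod>i\<in>UNIV. (b - a) $ i)"
    if "\<And>i. a $ i \<le> b $ i" for a b :: "real ^ 'k::finite"
  proof -
    have "a \<bullet> c \<le> b \<bullet> c" if "c \<in> Basis" for c
      using that \<open>\<And>i. a $ i \<le> b $ i\<close> by (auto simp: Basis_vec_def inner_axis)
    then show ?thesis by (simp add: prod_Basis_vec)
  qed
  have "?f -` box l u \<inter> space (lborel \<Otimes>\<^sub>M lborel) = box (vfst l) (vfst u) \<times> box (vsnd l) (vsnd u)"
    by (auto simp: space_pair_measure mem_box_cart vfst_def vsnd_def vpair_def split: sum.splits)
  then have "emeasure (distr (lborel \<Otimes>\<^sub>M lborel) borel ?f) (box l u)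
      = emeasure lborel (box (vfst l) (vfst u)) * emeasure lborel (box (vsnd l) (vsnd u))"
    by (simp add: emeasure_distr borel_measurable_vpair lborel.emeasure_pair_measure_Times)
  also have "\<dots> = ennreal ((\<Prod>i\<in>UNIV. (vfst u - vfst l) $ i) * (\<Prod>i\<in>UNIV. (vsnd u - vsnd l) $ i))"
    using le' by (subst (1 2) box) (auto simp: vfst_def vsnd_def ennreal_mult prod_nonneg)
  also have "(\<Prod>i\<in>UNIV. (vfst u - vfst l) $ i) * (\<Prod>i\<in>UNIV. (vsnd u - vsnd l) $ i) = (\<Prod>i\<in>UNIV. (u - l) $ i)"
    using prod.Plus[of UNIV UNIV "\<lambda>i. (u - l) $ i"] by (simp add: vfst_def vsnd_def comp_def)
  finally show "emeasure (distr (lborel \<Otimes>\<^sub>M lborel) borel ?f) (box l u) = (\<Prod>b\<in>Basis. (u - l) \<bullet> b)"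
    by (simp add: prod_Basis_vec)
qed simp

lemma borel_vpair_product:
  assumes [measurable]: "A \<in> sets borel" "B \<in> sets borel"
  shows "{z :: real ^ ('n::finite + 'm::finite). vfst z \<in> A \<and> vsnd z \<in> B} \<in> sets borel"
proof -
  have [measurable]: "(vfst :: real ^ ('n + 'm) \<Rightarrow> _) \<in> borel_measurable borel"
    "(vsnd :: real ^ ('n + 'm) \<Rightarrow> _) \<in> borel_measurable borel"
    unfolding vfst_def vsnd_def by (intro borel_measurable_continuous_onI continuous_intros)+
  show ?thesis by measurable
qed

lemma measure_lborel_vpair:
  assumes "A \<in> sets borel" "B \<in> sets borel"
  shows "measure lborel {z :: real ^ ('n::finite + 'm::finite). vfst z \<in> A \<and> vsnd z \<in> B}
    = measure lborel A * measure lborel B" (is "measure _ ?S = _")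
proof -
  have "?S \<in> sets borel" using assms by (rule borel_vpair_product)
  moreover have "(\<lambda>p. vpair (fst p) (snd p)) -` ?S \<inter> space (lborel \<Otimes>\<^sub>M lborel) = A \<times> B"
    by (auto simp: space_pair_measure)
  ultimately have "emeasure lborel ?S = emeasure lborel A * emeasure lborel B"
    by (subst lborel_vpair) (simp add: emeasure_distr borel_measurable_vpair lborel.emeasure_pair_measure_Times assms)
  then show ?thesis by (simp add: measure_def enn2real_mult)
qed

section \<open>Slices of the cone\<close>

text \<open>The slice of the cone over \<open>P\<close> at height \<open>t \<ge> 0\<close>; at height \<open>0\<close> it is the apex, even if \<open>P\<close> is
  empty.\<close>

definition dilate :: "real \<Rightarrow> (real ^ 'n) set \<Rightarrow> (real ^ 'n) set" where
  "dilate t P = (if t = 0 then {0} else {x. inverse t *\<^sub>R x \<in> P})"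

definition lattice_translates :: "(real ^ 'n) set \<Rightarrow> (real ^ 'n) set" where
  "lattice_translates A = {x. \<exists>u. x - rvec u \<in> A}"

text \<open>By convexity \<open>P \<times> {1}\<close> is its own convex hull, so the cone consists
  of the apex and the nonnegative multiples of that set, and the last coordinate reads off the
  multiple.\<close>

lemma mem_cone_iff_dilate:
  assumes "convex P" "0 \<le> t"
  shows "(x, t) \<in> convex_cone hull (P \<times> {1}) \<longleftrightarrow> x \<in> dilate t P"
proof -
  have "convex hull (P \<times> {1 :: real}) = P \<times> {1}"
    using assms(1) by (intro hull_same convex_Times) auto
  then have "(x, t) \<in> convex_cone hull (P \<times> {1}) \<longleftrightarrow> x = 0 \<and> t = 0 \<or> (\<exists>p\<in>P. x = t *\<^sub>R p)"
    using assms(2) by (force simp: convex_cone_hull_convex_hull zero_prod_def)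
  also have "\<dots> \<longleftrightarrow> x \<in> dilate t P"
  proof (cases "t = 0")
    case False
    then have "(\<exists>p\<in>P. x = t *\<^sub>R p) \<longleftrightarrow> inverse t *\<^sub>R x \<in> P" by force
    then show ?thesis using False by (simp add: dilate_def)
  qed (auto simp: dilate_def)
  finally show ?thesis .
qed

lemma closed_dilate: "closed P \<Longrightarrow> closed (dilate t P)"
  using continuous_closed_vimage[of P "\<lambda>x. inverse t *\<^sub>R x"] by (simp add: dilate_def vimage_def)

lemma borel_lattice_translates:
  fixes A :: "(real ^ 'n::finite) set"
  assumes "closed A"
  shows "lattice_translates A \<in> sets borel"
proof -
  have "closed {x. x - rvec u \<in> A}" for u
    using continuous_closed_vimage[OF assms, of "\<lambda>x. x - rvec u"] by (simp add: vimage_def)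
  then have "(\<Union>u. {x. x - rvec u \<in> A}) \<in> sets borel" by (intro sets.countable_UN') auto
  then show ?thesis by (simp add: lattice_translates_def Collect_ex_eq)
qed

lemma rvec_add_lattice_translates_iff: "rvec u + x \<in> lattice_translates A \<longleftrightarrow> x \<in> lattice_translates A"
proof
  assume "rvec u + x \<in> lattice_translates A"
  then obtain w where "rvec u + x - rvec w \<in> A" by (auto simp: lattice_translates_def)
  moreover have "rvec u + x - rvec w = x - rvec (w - u)" by (simp add: rvec_def vec_eq_iff)
  ultimately show "x \<in> lattice_translates A" by (auto simp: lattice_translates_def)
next
  assume "x \<in> lattice_translates A"
  then obtain w where "x - rvec w \<in> A" by (auto simp: lattice_translates_def)
  then have "rvec u + x - rvec (u + w) \<in> A" by (simp add: rvec_add)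
  then show "rvec u + x \<in> lattice_translates A" unfolding lattice_translates_def by blast
qed

lemma lattice_translates_vimage:
  "lattice_translates {x. x + c \<in> A} = {x. x + c \<in> lattice_translates A}"
  by (simp add: lattice_translates_def add_diff_eq diff_add_eq)

lemma lattice_translates_product:
  "lattice_translates {z. vfst z \<in> A \<and> vsnd z \<in> B}
    = {z. vfst z \<in> lattice_translates A \<and> vsnd z \<in> lattice_translates B}"
proof -
  have "vfst (z - rvec u) = vfst z - rvec (vfst u)" "vsnd (z - rvec u) = vsnd z - rvec (vsnd u)"
    for z :: "real ^ ('a + 'b)" and u
    by (simp_all add: vfst_def vsnd_def rvec_def vec_eq_iff)
  then show ?thesis unfolding lattice_translates_def
    by auto (metis vfst_vpair vsnd_vpair)
qed

lemma dilate_vimage: "dilate t {x. x + c \<in> P} = {x. x + t *\<^sub>R c \<in> dilate t P}"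
  by (simp add: dilate_def scaleR_add_right)

lemma dilate_product:
  "dilate t {z. vfst z \<in> P \<and> vsnd z \<in> Q} = {z. vfst z \<in> dilate t P \<and> vsnd z \<in> dilate t Q}"
  by (auto simp: dilate_def vfst_scaleR vsnd_scaleR vpair_eq_iff)

section \<open>Divisor polytopes and the covered volume\<close>

lemma divisor_polytope_Inter:
  "divisor_polytope F a = (\<Inter>v\<in>ray_generators F. {u. rvec v \<bullet> u \<ge> - real_of_int (a v)})"
  by (auto simp: divisor_polytope_def inner_commute)

lemma convex_divisor_polytope: "convex (divisor_polytope F a)"
  unfolding divisor_polytope_Inter by (intro convex_INT convex_halfspace_ge)

lemma closed_divisor_polytope: "closed (divisor_polytope F a)"
  unfolding divisor_polytope_Inter by (intro closed_INT ballI closed_halfspace_ge)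

text \<open>The translated cones have their apexes at height 1, so their slices at height
  \<open>t + 1\<close> are lattice translates of the slice of the cone at height \<open>t\<close>;
  the cube itself has volume 1.\<close>

proposition one_minus_phi_eq:
  fixes F :: "(real ^ 'n::finite) set set"
  assumes "0 \<le> t"
  shows "1 - phi F a t
    = measure lborel (unit_cube 0 \<inter> lattice_translates (dilate t (divisor_polytope F a)))"
proof -
  let ?U = "lattice_translates (dilate t (divisor_polytope F a))"
  have U: "?U \<in> sets borel"
    by (intro borel_lattice_translates closed_dilate closed_divisor_polytope)
  have cube: "(unit_cube 0 :: (real ^ 'n) set) \<in> sets borel" by (simp add: unit_cube_0)
  have "(x, t + 1) \<in> (\<Union>u :: int ^ 'n. (+) (rvec u, 1) ` divisor_cone F a) \<longleftrightarrow> x \<in> ?U" for x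
  proof -
    have "(x, t + 1) \<in> (+) (rvec u, 1) ` divisor_cone F a \<longleftrightarrow> x - rvec u \<in> dilate t (divisor_polytope F a)" for u
      unfolding mem_cone_iff_dilate[OF convex_divisor_polytope assms, symmetric] divisor_cone_def
      by (force simp: image_iff)
    then show ?thesis by (simp add: lattice_translates_def)
  qed
  then have "phi F a t = measure lebesgue (unit_cube 0 - ?U)"
    unfolding phi_def phi_at_def by (intro arg_cong[where f = "measure lebesgue"]) auto
  also have "\<dots> = measure lborel (unit_cube 0 - unit_cube 0 \<inter> ?U)"
    using U cube by (simp add: measure_completion Diff_Int)
  also have "\<dots> = measure lborel (unit_cube 0 :: (real ^ 'n) set) - measure lborel (unit_cube 0 \<inter> ?U)"
    using U cube by (intro measure_Diff) (auto simp: unit_cube_0 emeasure_lborel_cbox_eq)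
  finally show ?thesis by (simp add: measure_unit_cube)
qed

text \<open>At a ray \<open>vpair v 0\<close> the term \<open>pairing m (vpair v 0)\<close> moves to
  the other side, leaving the inequality of the first polytope for the first component of
  \<open>z + rvec m\<close>; likewise for the other rays.\<close>

lemma divisor_polytope_segre:
  assumes rays: "ray_generators (product_fan F G) =
      (\<lambda>v. vpair v 0) ` ray_generators F \<union> vpair 0 ` ray_generators G"
    and m: "\<And>v. v \<in> ray_generators F \<Longrightarrow> e (vpair v 0) = a v + pairing m (vpair v 0)"
      "\<And>w. w \<in> ray_generators G \<Longrightarrow> e (vpair 0 w) = b w + pairing m (vpair 0 w)"
  shows "divisor_polytope (product_fan F G) e
    = {z. z + rvec m \<in> {z. vfst z \<in> divisor_polytope F a \<and> vsnd z \<in> divisor_polytope G b}}"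
proof -
  have "- real_of_int (e (vpair v 0)) \<le> z \<bullet> rvec (vpair v 0) \<longleftrightarrow>
      - real_of_int (a v) \<le> vfst (z + rvec m) \<bullet> rvec v" if "v \<in> ray_generators F" for z v
    using m(1)[OF that] by (simp add: rvec_vpair inner_vpair vfst_add vfst_rvec inner_add_left inner_rvec
        pairing_vpair) linarith
  moreover have "- real_of_int (e (vpair 0 w)) \<le> z \<bullet> rvec (vpair 0 w) \<longleftrightarrow>
      - real_of_int (b w) \<le> vsnd (z + rvec m) \<bullet> rvec w" if "w \<in> ray_generators G" for z w
    using m(2)[OF that] by (simp add: rvec_vpair inner_vpair vsnd_add vsnd_rvec inner_add_left inner_rvec
        pairing_vpair) linarith
  ultimately show ?thesis by (simp add: divisor_polytope_def rays ball_Un)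
qed

theorem proposition1p4:
  fixes F :: "(real ^ 'n) set set" and a :: "int ^ 'n \<Rightarrow> int"
    and G :: "(real ^ 'm) set set" and b :: "int ^ 'm \<Rightarrow> int"
    and e :: "int ^ ('n::finite + 'm::finite) \<Rightarrow> int"
  assumes "perfect_field TYPE('k::field)"
    and "toric_pair TYPE('k) F a"
    and "toric_pair TYPE('k) G b"
    and "segre_divisor TYPE('k) F a G b e"
  shows "\<forall>t\<ge>0. 1 - phi (product_fan F G) e t = (1 - phi F a t) * (1 - phi G b t)"
proof (intro allI impI)
  fix t :: real assume t: "0 \<le> t"
  have F: "fan F" "F \<noteq> {}" and G: "fan G" "G \<noteq> {}"
    using assms(2,3) by (auto simp: toric_pair_def complete_fan_def)
  obtain m where m: "\<And>v. v \<in> ray_generators F \<Longrightarrow> e (vpair v 0) = a v + pairing m (vpair v 0)"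
    "\<And>w. w \<in> ray_generators G \<Longrightarrow> e (vpair 0 w) = b w + pairing m (vpair 0 w)"
    using segre_divisor_linearly_equivalent[OF F G assms(4)] by blast
  let ?U = "lattice_translates (dilate t (divisor_polytope F a))"
  let ?V = "lattice_translates (dilate t (divisor_polytope G b))"
  let ?W = "{z. vfst z \<in> ?U \<and> vsnd z \<in> ?V}"
  \<comment> \<open>Both dilating and forming all lattice translates commute with products, because
    a lattice vector of the product is an arbitrary pair of lattice vectors.\<close>
  have W: "?W = lattice_translates (dilate t {z. vfst z \<in> divisor_polytope F a \<and> vsnd z \<in> divisor_polytope G b})"
    by (simp only: dilate_product lattice_translates_product)
  have closed: "closed (dilate t (divisor_polytope F a))" "closed (dilate t (divisor_polytope G b))"
    by (intro closed_dilate closed_divisor_polytope)+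
  note borel = closed[THEN borel_lattice_translates]
  have W_borel: "?W \<in> sets borel" using borel by (rule borel_vpair_product)
  have polytope: "divisor_polytope (product_fan F G) e
      = {z. z + rvec m \<in> {z. vfst z \<in> divisor_polytope F a \<and> vsnd z \<in> divisor_polytope G b}}"
    by (rule divisor_polytope_segre[OF ray_generators_product_fan[OF F G]]) (simp_all add: m)
  have "1 - phi (product_fan F G) e t = measure lborel (unit_cube 0 \<inter> {z. z + t *\<^sub>R rvec m \<in> ?W})"
    unfolding one_minus_phi_eq[OF t] polytope dilate_vimage[of t "rvec m"]
      lattice_translates_vimage[of "t *\<^sub>R rvec m"] W ..
  \<comment> \<open>For general real \<open>t\<close> the shift \<open>t *\<^sub>R rvec m\<close> is
    not a lattice vector, so the set itself may change, but periodicity preserves its volume in the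
    cube.\<close>
  also have "\<dots> = measure lborel (unit_cube 0 \<inter> ?W)"
    by (rule measure_unit_cube_Int_translation[OF W_borel])
      (simp add: W rvec_add_lattice_translates_iff del: mem_Collect_eq)
  \<comment> \<open>The unit cube is a product as well, so the volume factors.\<close>
  also have "unit_cube 0 \<inter> ?W = {z. vfst z \<in> unit_cube 0 \<inter> ?U \<and> vsnd z \<in> unit_cube 0 \<inter> ?V}"
    by (auto simp: unit_cube_def vfst_def vsnd_def split_sum_all)
  also have "measure lborel \<dots> = measure lborel (unit_cube 0 \<inter> ?U) * measure lborel (unit_cube 0 \<inter> ?V)"
    using borel by (intro measure_lborel_vpair) (auto simp: unit_cube_0)
  finally show "1 - phi (product_fan F G) e t = (1 - phi F a t) * (1 - phi G b t)"
    by (simp only: one_minus_phi_eq[OF t])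
qed

end
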